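(* Let $\mathbf{Q}=(Q_m)_{m\ge0}$ be any strictly increasing sequence of positive real numbers with $Q_0>1$ and $Q_m\to\infty$, satisfying $$\inf_{m\ge0}\frac{Q_{m+1}}{Q_m^{\tau}}>0\quad\text{for some }\tau>1.$$ Then the set $$E_{\mathbf{Q}}=\Big\{(x,y)\in\mathbb{R}^2:\ \liminf_{m\to+\infty}\ Q_m\cdot\min_{1\le q\le Q_m}\langle qx\rangle\langle qy\rangle>0\Big\}$$ is hyperplane absolute winning (HAW) on $\mathbb{R}^2$. In particular, $\dim_H E_{\mathbf{Q}}=2$.
   Context: For $x\in\mathbb{R}$, $\langle x\rangle$ denotes the distance from $x$ to the nearest integer; $q$ ranges over positive integers. Hyperplane absolute winning (HAW) on $\mathbb{R}^d$: let $S\subset\mathbb{R}^d$ and $\beta\in(0,1/3)$. For an affine hyperplane $L\subset\mathbb{R}^d$ and $r>0$ put $L^{(r)}=\{z\in\mathbb{R}^d:\mathrm{dist}(z,L)\le r\}$. Bob first chooses a closed ball $B_0$ of radius $\rho_0>0$. After Bob chooses a closed ball $B_n$ of radius $\rho_n$, Alice chooses a hyperplane neighborhood $L_n^{(r_n)}$ with $r_n\le\beta\rho_n$, and then Bob chooses a closed ball $B_{n+1}\subset B_n\setminus L_n^{(r_n)}$ of radius $\rho_{n+1}\ge\beta\rho_n$. Alice wins by default if at any time Bob has no legal move, or if $\rho_n\not\to0$. Otherwise Alice wins if and only if $\bigcap_n B_n\cap S\ne\varnothing$. $S$ is $\beta$-HAW if Alice has a winning strategy, and HAW if it is $\beta$-HAW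 for every $\beta\in(0,1/3)$. *)

theory Defs
  imports "HOL-Analysis.Analysis"
begin

definition nearest_int_dist :: "real \<Rightarrow> real"  ("\<langle>_\<rangle>")
  where "\<langle>x\<rangle> = \<bar>x - of_int (round x)\<bar>"


definition affine_hyperplane :: "'a::euclidean_space set \<Rightarrow> bool"
  where "affine_hyperplane L \<longleftrightarrow> (\<exists>a b. a \<noteq> 0 \<and> L = {z. a \<bullet> z = b})"

definition hyperplane_nbhd :: "'a::euclidean_space set \<Rightarrow> real \<Rightarrow> 'a set"
  where "hyperplane_nbhd L r = {z. infdist z L \<le> r}"

text \<open>
  A closed ball is represented by its centre and radius, which it determines since
  radii are positive; a hyperplane neighbourhood is represented by the
  hyperplane and the radius that Alice chooses.
\<close>

type_synonym 'a game_ball = "'a \<times> real"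
type_synonym 'a game_nbhd = "'a set \<times> real"

definition ball_set :: "'a::euclidean_space game_ball \<Rightarrow> 'a set"
  where "ball_set B = cball (fst B) (snd B)"

definition alice_legal ::
    "real \<Rightarrow> 'a::euclidean_space game_ball \<Rightarrow> 'a game_nbhd \<Rightarrow> bool"
  where "alice_legal \<beta> B M \<longleftrightarrow>
    affine_hyperplane (fst M) \<and> 0 < snd M \<and> snd M \<le> \<beta> * snd B"

definition bob_legal ::
    "real \<Rightarrow> 'a::euclidean_space game_ball \<Rightarrow> 'a game_nbhd \<Rightarrow> 'a game_ball \<Rightarrow> bool"
  where "bob_legal \<beta> B M B' \<longleftrightarrow>
    0 < snd B' \<and> \<beta> * snd B \<le> snd B' \<and>
    ball_set B' \<subseteq> ball_set B - hyperplane_nbhd (fst M) (snd M)"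

text \<open>
  A strategy of Alice answers the list \<open>[B\<^sub>0, \<dots>, B\<^sub>n]\<close> of all balls chosen so far;
  her own earlier moves are determined by this list and the strategy.
\<close>

type_synonym 'a alice_strategy = "'a game_ball list \<Rightarrow> 'a game_nbhd"

text \<open>
  The balls \<open>B 0, \<dots>, B n\<close> are legal choices of Bob when Alice follows \<open>\<sigma>\<close>.
\<close>

definition legal_play_upto ::
    "real \<Rightarrow> 'a::euclidean_space alice_strategy \<Rightarrow> nat \<Rightarrow> (nat \<Rightarrow> 'a game_ball) \<Rightarrow> bool"
  where "legal_play_upto \<beta> \<sigma> n B \<longleftrightarrow>
    0 < snd (B 0) \<and>
    (\<forall>k<n. bob_legal \<beta> (B k) (\<sigma> (map B [0..<Suc k])) (B (Suc k)))"

text \<open>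
  A winning strategy gives a legal move in every position that it can reach. Only
  infinite plays with radii tending to \<open>0\<close> impose a further condition: Alice wins by default
  if Bob gets stuck or if the radii do not tend to \<open>0\<close>.
\<close>

definition winning_strategy ::
    "real \<Rightarrow> 'a::euclidean_space set \<Rightarrow> 'a alice_strategy \<Rightarrow> bool"
  where "winning_strategy \<beta> S \<sigma> \<longleftrightarrow>
    (\<forall>n B. legal_play_upto \<beta> \<sigma> n B \<longrightarrow> alice_legal \<beta> (B n) (\<sigma> (map B [0..<Suc n]))) \<and>
    (\<forall>B. (\<forall>n. legal_play_upto \<beta> \<sigma> n B) \<and> (\<lambda>n. snd (B n)) \<longlonglongrightarrow> 0 \<longrightarrow>
         (\<Inter>n. ball_set (B n)) \<inter> S \<noteq> {})"

definition beta_HAW :: "real \<Rightarrow> 'a::euclidean_space set \<Rightarrow> bool"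
  where "beta_HAW \<beta> S \<longleftrightarrow> (\<exists>\<sigma>. winning_strategy \<beta> S \<sigma>)"

definition HAW :: "'a::euclidean_space set \<Rightarrow> bool"
  where "HAW S \<longleftrightarrow> (\<forall>\<beta>. 0 < \<beta> \<and> \<beta> < 1/3 \<longrightarrow> beta_HAW \<beta> S)"


text \<open>
  The power \<open>(diam U)\<^sup>s\<close> with the conventions that make the \<open>0\<close>-dimensional measure the
  counting measure: the empty set has weight \<open>0\<close>, and \<open>0\<^sup>0 = 1\<close> otherwise
  (whereas \<open>0 powr 0 = 0\<close>).
\<close>

definition diameter_power :: "real \<Rightarrow> 'a::metric_space set \<Rightarrow> ennreal"
  where "diameter_power s U =
    (if U = {} then 0 else if s = 0 then 1 else ennreal (diameter U powr s))"

text \<open>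
  Boundedness of the covering sets is required explicitly because \<open>diameter\<close> is real-valued and
  has no meaningful value on unbounded sets.
\<close>

definition hausdorff_premeasure :: "real \<Rightarrow> real \<Rightarrow> 'a::metric_space set \<Rightarrow> ennreal"
  where "hausdorff_premeasure s \<delta> A =
    (INF U \<in> {U :: nat \<Rightarrow> 'a set. A \<subseteq> (\<Union>i. U i) \<and>
                (\<forall>i. bounded (U i) \<and> diameter (U i) \<le> \<delta>)}.
       (\<Sum>i. diameter_power s (U i)))"

definition hausdorff_measure :: "real \<Rightarrow> 'a::metric_space set \<Rightarrow> ennreal"
  where "hausdorff_measure s A = (SUP \<delta>\<in>{0<..}. hausdorff_premeasure s \<delta> A)"

definition hausdorff_dim :: "'a::metric_space set \<Rightarrow> ennreal"
  where "hausdorff_dim A = (INF s \<in> {s. 0 \<le> s \<and> hausdorff_measure s A = 0}. ennreal s)"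


definition E_set :: "(nat \<Rightarrow> real) \<Rightarrow> (real \<times> real) set"
  where "E_set Q = {(x, y).
    liminf (\<lambda>m. ereal (Q m *
      (MIN q\<in>{q::nat. 1 \<le> q \<and> real q \<le> Q m}. \<langle>real q * x\<rangle> * \<langle>real q * y\<rangle>))) > 0}"

end

theory Submission
  imports Defs
begin

text \<open>
  HAW. Fix \<open>Q = Q\<^sub>m\<close>. If \<open>\<langle>qx\<rangle>\<langle>qy\<rangle> \<le> \<theta>\<^sup>2/Q\<close> for some \<open>q \<le> Q\<close>, with \<open>P = (p1/q, p2/q)\<close> the
  nearest rational point, then Minkowski's theorem in the shape of that region gives a rational line
  \<open>L: A x + B y + C = 0\<close> through \<open>P\<close> with \<open>|AB| \<le> q\<close> such that \<open>(x, y)\<close> is in a thin strip around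
  \<open>L\<close>. Sort the pairs \<open>(P, L)\<close> by the dyadic sizes of \<open>A, B, q\<close>. In a ball whose radius exceeds
  the width of the strip by a factor \<open>\<omega> (8Q/|AB|)\<^sup>1\<^sup>/\<^sup>4\<close>, each class contributes at most one line: two
  lines of one class would meet in a rational point \<open>P'\<close> for which either \<open>P P'\<close> forces \<open>P = P'\<close>, or
  \<open>P'\<close> violates the same inequality with a smaller denominator. The gain of a power of
  \<open>Q/|AB|\<close> makes the sum over all classes of one scale converge, and the growth of \<open>Q\<^sub>m\<close> leaves only
  boundedly many \<open>m\<close> relevant at each scale. So Alice has to avoid, at each scale, strips whose
  widths have a small \<open>c\<close>-th power sum, which she does by a potential argument.

  Dimension. Given a cover of small \<open>s\<close>-dimensional weight, \<open>s < 2\<close>, Bob always finds among the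
  \<open>\<approx> \<beta>\<^sup>-\<^sup>2\<close> disjoint balls available to him one that meets at most the proportion \<open>\<beta>\<^sup>s\<close> of the
  weight, so a HAW set cannot be covered.
\<close>

section \<open>Potential strategies for Alice\<close>

text \<open>The exponent 1/4 comes from the uniqueness argument. Allowing balls \<Omega> = \<omega>
  g times the width of the strip enlarges the bounds on the linear forms by \<Omega>, so P'
  contradicts the inequality as soon as \<Omega>^2 |AB| is small against q. Where the points cannot
  be forced onto P', q/Q is at least of order (\<Omega>\<theta>)^-2. Both facts combine when
  (\<theta>\<omega>^2)^2 g^4 |AB| is small against Q, which g^4 = 8Q/|AB| and a small fixed
  \<theta>\<omega>^2 achieve. The second difficulty is that Alice names strips knowing only the
  ball, whereas uniqueness holds only at points that satisfy the inequality for all smaller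
  denominators. She takes an arbitrary line of the class that comes near the ball; uniqueness is
  used afterwards, at the outcome of the game, by induction on the denominator.\<close>

definition meets :: "'a::euclidean_space game_ball \<Rightarrow> 'a game_nbhd \<Rightarrow> bool"
  where "meets B M \<longleftrightarrow> ball_set B \<inter> hyperplane_nbhd (fst M) (snd M) \<noteq> {}"

lemma uniform_ball_cover:
  fixes \<delta> :: real
  assumes "0 < \<delta>"
  obtains N :: nat where "N > 0"
    "\<And>(x::'a::euclidean_space) \<rho>. 0 < \<rho> \<Longrightarrow>
       \<exists>K. finite K \<and> card K \<le> N \<and> cball x \<rho> \<subseteq> (\<Union>k\<in>K. cball k (\<delta> * \<rho>))"
proof -
  have "compact (cball (0::'a) 1)" by simp
  then obtain K0 where K0: "finite K0" "cball (0::'a) 1 \<subseteq> (\<Union>k\<in>K0. ball k \<delta>)"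
    using assms unfolding compact_eq_totally_bounded by metis
  show ?thesis
  proof (rule that[of "card K0 + 1"])
    fix x :: 'a and \<rho> :: real assume \<rho>: "0 < \<rho>"
    let ?K = "(\<lambda>k. x + \<rho> *\<^sub>R k) ` K0"
    have "cball x \<rho> \<subseteq> (\<Union>k\<in>?K. cball k (\<delta> * \<rho>))"
    proof
      fix y assume y: "y \<in> cball x \<rho>"
      let ?z = "(1 / \<rho>) *\<^sub>R (y - x)"
      have "?z \<in> cball 0 1"
        using y \<rho> by (simp add: dist_norm norm_minus_commute)
      then obtain k where k: "k \<in> K0" "dist k ?z < \<delta>" using K0 by force
      have "(x + \<rho> *\<^sub>R k) - y = \<rho> *\<^sub>R (k - ?z)" using \<rho> by (simp add: algebra_simps)
      then have "dist (x + \<rho> *\<^sub>R k) y = \<rho> * dist k ?z"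
        using \<rho> by (simp add: dist_norm)
      also have "\<dots> \<le> \<delta> * \<rho>" using k \<rho> by simp
      finally show "y \<in> (\<Union>k\<in>?K. cball k (\<delta> * \<rho>))" using k by auto
    qed
    moreover have "card ?K \<le> card K0 + 1" using card_image_le[OF K0(1)] by (metis le_SucI Suc_eq_plus1)
    ultimately show "\<exists>K. finite K \<and> card K \<le> card K0 + 1 \<and> cball x \<rho> \<subseteq> (\<Union>k\<in>K. cball k (\<delta> * \<rho>))"
      using K0(1) by blast
  qed simp
qed

text \<open>If every strip in \<open>U\<close> were a bad choice, pigeonhole the centres of the balls refuting it
  into a net of \<open>N\<close> points; the smallest ball of the heaviest cell then avoids all
  strips of that cell, since it is a translate of a part of each ball in the cell.\<close>

lemma heavy_strip_removal:
  fixes U :: "'a::euclidean_space game_nbhd set" and W :: "'a game_nbhd \<Rightarrow> real"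
  assumes U: "finite U" "U \<noteq> {}" and W: "\<And>M. M \<in> U \<Longrightarrow> 0 \<le> W M"
    and thin: "\<And>M. M \<in> U \<Longrightarrow> snd M \<le> \<beta> * \<rho> / 2"
    and K: "finite K" "card K \<le> N" "cball x \<rho> \<subseteq> (\<Union>k\<in>K. cball k (\<beta> / 4 * \<rho>))"
    and N: "N > 0" and \<beta>: "0 < \<beta>" and \<rho>: "0 < \<rho>"
  shows "\<exists>M\<in>U. \<forall>B'. bob_legal \<beta> (x, \<rho>) (fst M, \<beta> * \<rho>) B' \<longrightarrow>
           (\<Sum>M\<in>{M\<in>U. meets B' M}. W M) \<le> (1 - 1 / N) * sum W U"
proof (rule ccontr)
  assume "\<not> ?thesis"
  then have "\<forall>M\<in>U. \<exists>B'. bob_legal \<beta> (x, \<rho>) (fst M, \<beta> * \<rho>) B' \<and>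
      (\<Sum>M\<in>{M\<in>U. meets B' M}. W M) > (1 - 1 / N) * sum W U" by (meson not_le)
  then obtain f where f: "\<And>M. M \<in> U \<Longrightarrow> bob_legal \<beta> (x, \<rho>) (fst M, \<beta> * \<rho>) (f M)"
    "\<And>M. M \<in> U \<Longrightarrow> (\<Sum>M\<in>{M'\<in>U. meets (f M) M'}. W M) > (1 - 1 / N) * sum W U"
    unfolding bchoice_iff by blast
  have rpos: "0 < snd (f M)" if "M \<in> U" for M using f(1)[OF that] by (simp add: bob_legal_def)
  have "fst (f M) \<in> cball x \<rho>" if "M \<in> U" for M
  proof -
    have "fst (f M) \<in> ball_set (f M)" using rpos[OF that] by (simp add: ball_set_def)
    moreover have "ball_set (f M) \<subseteq> cball x \<rho>"
      using f(1)[OF that] by (auto simp: bob_legal_def ball_set_def[of "(x, \<rho>)"])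
    ultimately show ?thesis by blast
  qed
  then have "\<forall>M\<in>U. \<exists>k\<in>K. dist k (fst (f M)) \<le> \<beta> / 4 * \<rho>" using K(3) by fastforce
  then obtain p where p: "\<And>M. M \<in> U \<Longrightarrow> p M \<in> K" "\<And>M. M \<in> U \<Longrightarrow> dist (p M) (fst (f M)) \<le> \<beta> / 4 * \<rho>"
    by metis
  define C where "C k = {M\<in>U. p M = k}" for k
  have "sum W U = (\<Sum>k\<in>K. sum W (C k))"
    unfolding C_def using sum.group[OF U(1) K(1), of p W] p(1) by (simp add: image_subset_iff)
  obtain M0 where M0: "M0 \<in> U" using U by blast
  have Kne: "K \<noteq> {}" using p(1) M0 by blast
  have pos: "0 < sum W U"
  proof (rule ccontr)
    assume "\<not> 0 < sum W U"
    then have z: "sum W U = 0" using sum_nonneg[of U W] W by fastforce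
    have "(\<Sum>M\<in>{M'\<in>U. meets (f M0) M'}. W M) \<le> sum W U"
      by (rule sum_mono2) (use U W in auto)
    then show False using f(2)[OF M0] z by simp
  qed
  have "\<exists>k\<in>K. sum W U / N \<le> sum W (C k)"
  proof (rule ccontr)
    assume "\<not> ?thesis"
    then have "(\<Sum>k\<in>K. sum W (C k)) < (\<Sum>k\<in>K. sum W U / N)"
      using K(1) Kne by (intro sum_strict_mono) auto
    also have "\<dots> = card K * (sum W U / N)" by simp
    also have "\<dots> \<le> N * (sum W U / N)" using K(2) pos by (intro mult_right_mono) auto
    finally show False using \<open>sum W U = _\<close> N by simp
  qed
  then obtain k where k: "k \<in> K" "sum W U / N \<le> sum W (C k)" by blast
  have "C k \<noteq> {}"
  proof
    assume "C k = {}"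
    then have "sum W U / N \<le> 0" using k(2) by simp
    then show False using pos N by (simp add: divide_le_0_iff)
  qed
  moreover have fC: "finite (C k)" using U(1) by (simp add: C_def)
  ultimately obtain J where J: "J \<in> C k" "\<And>M. M \<in> C k \<Longrightarrow> snd (f J) \<le> snd (f M)"
    using arg_min_if_finite[of "C k" "\<lambda>M. snd (f M)"] by (metis not_less)
  have JU: "J \<in> U" using J(1) by (simp add: C_def)
  have no: "\<not> meets (f J) M" if M: "M \<in> C k" for M
  proof
    assume "meets (f J) M"
    then obtain y where y: "y \<in> cball (fst (f J)) (snd (f J))" "infdist y (fst M) \<le> snd M"
      by (auto simp: meets_def ball_set_def hyperplane_nbhd_def)
    have MU: "M \<in> U" "p M = k" using M by (auto simp: C_def)
    \<comment> \<open>The constants are matched here: centres sharing a net point of mesh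
      \<beta>\<rho>/4 differ by at most \<beta>\<rho>/2, and with a strip of half-width at most
      \<beta>\<rho>/2 this stays within the \<beta>\<rho> that Alice removes.\<close>
    let ?v = "fst (f M) - fst (f J)"
    have "p J = k" using J(1) by (simp add: C_def)
    then have "dist (fst (f M)) (fst (f J)) \<le> \<beta> / 4 * \<rho> + \<beta> / 4 * \<rho>"
      using dist_triangle3[of "fst (f M)" "fst (f J)" k] p(2)[OF MU(1)] p(2)[OF JU] MU(2) by simp
    then have v: "norm ?v \<le> \<beta> * \<rho> / 2" by (simp add: dist_norm)
    have "dist (fst (f M)) (y + ?v) = dist (fst (f J)) y" by (simp add: dist_norm algebra_simps)
    then have "y + ?v \<in> ball_set (f M)" using y(1) J(2)[OF M] by (simp add: ball_set_def)
    then have "\<beta> * \<rho> < infdist (y + ?v) (fst M)"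
      using f(1)[OF MU(1)] by (auto simp: bob_legal_def hyperplane_nbhd_def)
    also have "\<dots> \<le> infdist y (fst M) + dist (y + ?v) y" by (rule infdist_triangle)
    also have "\<dots> \<le> \<beta> * \<rho> / 2 + \<beta> * \<rho> / 2"
      using y(2) thin[OF MU(1)] v by (intro add_mono) (auto simp: dist_norm)
    finally show False by simp
  qed
  have "(\<Sum>M\<in>{M'\<in>U. meets (f J) M'}. W M) \<le> sum W (U - C k)"
    by (rule sum_mono2) (use U W no in auto)
  also have "\<dots> = sum W U - sum W (C k)"
    using U(1) by (simp add: sum_diff C_def)
  also have "\<dots> \<le> (1 - 1 / N) * sum W U" using k(2) by (simp add: algebra_simps)
  finally show False using f(2)[OF JU] by simp
qed

lemma powr_base_le_cancel:
  fixes x y c :: real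
  assumes "x powr c \<le> y powr c" "0 < x" "0 \<le> y" "0 < c"
  shows "x \<le> y"
  using assms powr_less_mono2[of c y x] by (cases "x \<le> y") auto

lemma exists_affine_hyperplane: "\<exists>L::'a::euclidean_space set. affine_hyperplane L"
proof -
  obtain i :: 'a where "i \<in> Basis" using nonempty_Basis by blast
  then have "i \<noteq> 0" by (rule nonzero_Basis)
  then have "affine_hyperplane {z. i \<bullet> z = 0}" unfolding affine_hyperplane_def by blast
  then show ?thesis ..
qed

text \<open>This passes from a game in which Alice names many strips of small total weight at once
  to one in which she removes a single strip. She remembers every strip named so far that still
  meets the current ball and keeps their total weight below (\<eta>\<rho>)^c. One move cuts the
  weight by the factor 1 - 1/N; the loss \<beta>^-c from the smaller radius and the newly named
  strips both fit into this gain. A strip containing the outcome is never discarded, so its width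
  would be at most \<eta> times radii tending to 0.\<close>

theorem potential_beta_HAW:
  fixes \<beta> :: real
  assumes \<beta>: "0 < \<beta>" "\<beta> < 1"
  obtains c \<epsilon> :: real where "0 < c" "0 < \<epsilon>"
    "\<And>(F :: 'a::euclidean_space game_ball \<Rightarrow> 'a game_nbhd set) S.
      \<lbrakk>\<And>B. 0 < snd B \<Longrightarrow> finite (F B);
       \<And>B M. 0 < snd B \<Longrightarrow> M \<in> F B \<Longrightarrow> affine_hyperplane (fst M) \<and> 0 < snd M;
       \<And>B. 0 < snd B \<Longrightarrow> (\<Sum>M\<in>F B. snd M powr c) \<le> (\<epsilon> * snd B) powr c;
       \<And>B z. \<lbrakk>\<And>n. 0 < snd (B n); \<And>n. \<beta> * snd (B n) \<le> snd (B (Suc n));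
               (\<lambda>n. snd (B n)) \<longlonglongrightarrow> 0; \<And>n. z \<in> ball_set (B n);
               \<And>n M. M \<in> F (B n) \<Longrightarrow> z \<notin> hyperplane_nbhd (fst M) (snd M)\<rbrakk> \<Longrightarrow> z \<in> S\<rbrakk>
      \<Longrightarrow> beta_HAW \<beta> S"
proof -
  obtain N :: nat where N: "N > 0" and cover: "\<And>(x::'a) \<rho>. 0 < \<rho> \<Longrightarrow>
       \<exists>K. finite K \<and> card K \<le> N \<and> cball x \<rho> \<subseteq> (\<Union>k\<in>K. cball k (\<beta> / 4 * \<rho>))"
    using uniform_ball_cover[of "\<beta> / 4"] \<beta> by (metis divide_pos_pos zero_less_numeral)
  define \<kappa> where "\<kappa> = 1 - 1 / (2 * real N)"
  have \<kappa>: "0 < \<kappa>" "\<kappa> < 1" using N by (auto simp: \<kappa>_def field_simps)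
  text \<open>The exponent is so small that \<open>(1 - 1/N) \<beta>\<^sup>-\<^sup>c \<le> 1 - 1/(2N)\<close>.\<close>
  have "((\<lambda>c. (1 - 1 / N) * \<beta> powr (- c)) \<longlongrightarrow> (1 - 1 / N) * \<beta> powr (- 0)) (at_right 0)"
    using \<beta> by (intro tendsto_intros) auto
  moreover have "(1 - 1 / N) * \<beta> powr (- 0) < \<kappa>" using \<beta> N by (simp add: \<kappa>_def field_simps)
  ultimately have "\<forall>\<^sub>F c in at_right 0. (1 - 1 / N) * \<beta> powr (- c) < \<kappa>"
    by (rule order_tendstoD(2))
  then obtain b where b: "0 < b" "\<And>c. 0 < c \<Longrightarrow> c < b \<Longrightarrow> (1 - 1 / N) * \<beta> powr (- c) < \<kappa>"
    unfolding eventually_at_right_field by auto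
  define c where "c = b / 2"
  have c: "0 < c" "(1 - 1 / N) * \<beta> powr (- c) \<le> \<kappa>" using b(1) b(2)[of c] by (auto simp: c_def)
  \<comment> \<open>With \<eta> = \<beta>/2 the bound on the total weight also bounds each single
    width by \<beta>\<rho>/2, as \<open>heavy_strip_removal\<close> requires. Below, \<epsilon>^c is
    the share 1/(2N) of \<eta>^c that \<kappa> leaves for new strips.\<close>
  define \<eta> where "\<eta> = \<beta> / 2"
  have \<eta>: "0 < \<eta>" using \<beta> by (simp add: \<eta>_def)
  define \<epsilon> where "\<epsilon> = \<eta> * (1 / (2 * real N)) powr (1 / c)"
  have \<epsilon>: "0 < \<epsilon>" using \<eta> N by (simp add: \<epsilon>_def)
  have \<epsilon>c: "\<epsilon> powr c = \<eta> powr c * (1 / (2 * real N))"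
    using \<eta> c N by (simp add: \<epsilon>_def powr_mult powr_powr)
  have \<epsilon>\<eta>: "\<epsilon> powr c \<le> \<eta> powr c" unfolding \<epsilon>c using N by (intro mult_left_le) auto
  show ?thesis
  proof (rule that[OF c(1) \<epsilon>])
    fix F :: "'a game_ball \<Rightarrow> 'a game_nbhd set" and S
    assume fin: "\<And>B. 0 < snd B \<Longrightarrow> finite (F B)"
      and hyp: "\<And>B M. 0 < snd B \<Longrightarrow> M \<in> F B \<Longrightarrow> affine_hyperplane (fst M) \<and> 0 < snd M"
      and small: "\<And>B. 0 < snd B \<Longrightarrow> (\<Sum>M\<in>F B. snd M powr c) \<le> (\<epsilon> * snd B) powr c"
      and win: "\<And>B z. \<lbrakk>\<And>n. 0 < snd (B n); \<And>n. \<beta> * snd (B n) \<le> snd (B (Suc n));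
               (\<lambda>n. snd (B n)) \<longlonglongrightarrow> 0; \<And>n. z \<in> ball_set (B n);
               \<And>n M. M \<in> F (B n) \<Longrightarrow> z \<notin> hyperplane_nbhd (fst M) (snd M)\<rbrakk> \<Longrightarrow> z \<in> S"
    define W where "W M = snd M powr c" for M :: "'a game_nbhd"
    define U where "U h = {M \<in> (\<Union>B\<in>set h. F B). meets (last h) M}" for h
    define good where "good h L \<longleftrightarrow> affine_hyperplane L \<and>
       (\<forall>B'. bob_legal \<beta> (last h) (L, \<beta> * snd (last h)) B' \<longrightarrow>
           (\<Sum>M\<in>{M\<in>U h. meets B' M}. W M) \<le> (1 - 1 / N) * sum W (U h))" for h L
    define \<sigma> where "\<sigma> h = (SOME L. good h L, \<beta> * snd (last h))" for h
    have W0: "0 \<le> W M" for M by (simp add: W_def)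
    have inv: "finite (U h) \<and> sum W (U h) \<le> (\<eta> * snd (last h)) powr c \<and> good h (fst (\<sigma> h)) \<and> 0 < snd (B n)"
      if "legal_play_upto \<beta> \<sigma> n B" "h = map B [0..<Suc n]" for n B h
      using that
    proof (induction n arbitrary: h)
      have good: "good h (fst (\<sigma> h))"
        if U: "finite (U h)" "sum W (U h) \<le> (\<eta> * snd (last h)) powr c" and h: "h \<noteq> []" "\<forall>B\<in>set h. 0 < snd B"
        for h :: "'a game_ball list"
      proof -
        have hU: "affine_hyperplane (fst M) \<and> 0 < snd M" if MU: "M \<in> U h" for M
        proof -
          obtain B where "B \<in> set h" "M \<in> F B" using MU unfolding U_def by blast
          then show ?thesis using h(2) hyp by blast
        qed
        have "\<exists>L. good h L"
        proof (cases "U h = {}")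
          case True
          then show ?thesis using exists_affine_hyperplane by (auto simp: good_def)
        next
          case False
          obtain x \<rho> where x: "last h = (x, \<rho>)" by fastforce
          have \<rho>: "0 < \<rho>" using h last_in_set[OF h(1)] x by force
          obtain K where K: "finite K" "card K \<le> N" "cball x \<rho> \<subseteq> (\<Union>k\<in>K. cball k (\<beta> / 4 * \<rho>))"
            using cover[OF \<rho>] by blast
          have thin: "snd M \<le> \<beta> * \<rho> / 2" if "M \<in> U h" for M
          proof -
            have "W M \<le> sum W (U h)" using U(1) that W0 by (intro member_le_sum) auto
            then have "snd M powr c \<le> (\<beta> * \<rho> / 2) powr c" using U(2) x by (simp add: W_def \<eta>_def)
            moreover have "0 < snd M" using hU[OF that] by simp
            ultimately show ?thesis
              using c(1) \<beta> \<rho> powr_base_le_cancel[of "snd M" c "\<beta> * \<rho> / 2"] by simp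
          qed
          obtain M where "M \<in> U h" "\<forall>B'. bob_legal \<beta> (x, \<rho>) (fst M, \<beta> * \<rho>) B' \<longrightarrow>
             (\<Sum>M\<in>{M\<in>U h. meets B' M}. W M) \<le> (1 - 1 / N) * sum W (U h)"
            using heavy_strip_removal[OF U(1) False _ thin K N \<beta>(1) \<rho>, of W] W0 by blast
          moreover have "affine_hyperplane (fst M)" using \<open>M \<in> U h\<close> hU by simp
          ultimately show ?thesis using x by (auto simp: good_def)
        qed
        then show ?thesis unfolding \<sigma>_def by (simp add: someI_ex)
      qed
      have pos: "0 < snd (B k)" if "legal_play_upto \<beta> \<sigma> n B" "k \<le> n" for n k
        using that by (cases k) (auto simp: legal_play_upto_def bob_legal_def)
      {
        case 0
        have 1: "0 < snd (B 0)" using 0 by (simp add: legal_play_upto_def)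
        have sub: "U h \<subseteq> F (B 0)" using 0 by (auto simp: U_def)
        have "sum W (U h) \<le> sum W (F (B 0))" using sub fin[OF 1] W0 by (intro sum_mono2) auto
        also have "\<dots> \<le> (\<epsilon> * snd (B 0)) powr c" using small[OF 1] by (simp add: W_def)
        also have "\<dots> \<le> (\<eta> * snd (B 0)) powr c"
          using 1 \<eta> \<epsilon> \<epsilon>\<eta> by (simp add: powr_mult mult_right_mono)
        finally have 2: "sum W (U h) \<le> (\<eta> * snd (last h)) powr c" using 0 by simp
        show ?case using good[OF finite_subset[OF sub fin[OF 1]] 2] 0 1 2 finite_subset[OF sub fin[OF 1]] by simp
      next
        case (Suc n)
        let ?h = "map B [0..<Suc n]" and ?\<rho> = "snd (B n)" and ?\<rho>' = "snd (B (Suc n))"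
        have leg: "legal_play_upto \<beta> \<sigma> n B" "bob_legal \<beta> (B n) (\<sigma> ?h) (B (Suc n))"
          using Suc.prems by (auto simp: legal_play_upto_def)
        have IH: "finite (U ?h)" "sum W (U ?h) \<le> (\<eta> * ?\<rho>) powr c" "good ?h (fst (\<sigma> ?h))" "0 < ?\<rho>"
          using Suc.IH[OF leg(1) refl] by auto
        have \<rho>': "\<beta> * ?\<rho> \<le> ?\<rho>'" "0 < ?\<rho>'" using leg(2) by (auto simp: bob_legal_def)
        let ?V = "{M\<in>U ?h. meets (B (Suc n)) M}"
        have h: "h = ?h @ [B (Suc n)]" using Suc.prems by simp
        have step: "ball_set (B (Suc n)) \<subseteq> ball_set (B n)" using leg(2) by (auto simp: bob_legal_def)
        have sub: "U h \<subseteq> ?V \<union> F (B (Suc n))"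
        proof
          fix M assume M: "M \<in> U h"
          then have m: "meets (B (Suc n)) M" using h by (auto simp: U_def)
          then have "meets (B n) M" using step by (auto simp: meets_def)
          then show "M \<in> ?V \<union> F (B (Suc n))" using M m h by (auto simp: U_def)
        qed
        have fV: "finite ?V" using IH(1) by simp
        have \<sigma>h: "\<sigma> ?h = (fst (\<sigma> ?h), \<beta> * ?\<rho>)" by (simp add: \<sigma>_def)
        have "bob_legal \<beta> (B n) (fst (\<sigma> ?h), \<beta> * ?\<rho>) (B (Suc n))" using leg(2) \<sigma>h by simp
        moreover have last_h: "last ?h = B n" by simp
        ultimately have V: "sum W ?V \<le> (1 - 1 / N) * sum W (U ?h)"
          using IH(3) unfolding good_def last_h by blast
        have finU: "finite (U h)" using finite_subset[OF sub] fV fin[OF \<rho>'(2)] by blast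
        have "sum W (U h) \<le> sum W (?V \<union> F (B (Suc n)))"
          using sub fV fin[OF \<rho>'(2)] W0 by (intro sum_mono2) auto
        also have "\<dots> \<le> sum W ?V + sum W (F (B (Suc n)))"
          using sum.union_inter[OF fV fin[OF \<rho>'(2)], of W] sum_nonneg[of "?V \<inter> F (B (Suc n))" W] W0 by simp
        also have "\<dots> \<le> (1 - 1 / N) * (\<eta> * ?\<rho>) powr c + (\<epsilon> * ?\<rho>') powr c"
        proof (rule add_mono)
          have "(1 - 1 / N) * sum W (U ?h) \<le> (1 - 1 / N) * (\<eta> * ?\<rho>) powr c"
            using IH(2) N by (intro mult_left_mono) auto
          then show "sum W ?V \<le> (1 - 1 / N) * (\<eta> * ?\<rho>) powr c" using V by simp
          show "sum W (F (B (Suc n))) \<le> (\<epsilon> * ?\<rho>') powr c" using small[OF \<rho>'(2)] by (simp add: W_def)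
        qed
        also have "(1 - 1 / N) * (\<eta> * ?\<rho>) powr c \<le> \<kappa> * (\<eta> * ?\<rho>') powr c"
        proof -
          have "(\<eta> * ?\<rho>) powr c \<le> (\<eta> * (?\<rho>' / \<beta>)) powr c"
            using \<rho>' \<beta> \<eta> IH(4) c by (intro powr_mono2 mult_left_mono) (auto simp: field_simps)
          also have "\<dots> = \<beta> powr (- c) * (\<eta> * ?\<rho>') powr c"
            using \<rho>' \<beta> \<eta> by (simp add: powr_mult powr_divide powr_minus field_simps)
          finally have "(1 - 1 / N) * (\<eta> * ?\<rho>) powr c \<le> (1 - 1 / N) * (\<beta> powr (- c) * (\<eta> * ?\<rho>') powr c)"
            using N by (intro mult_left_mono) auto
          also have "\<dots> \<le> \<kappa> * (\<eta> * ?\<rho>') powr c"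
            using mult_right_mono[OF c(2), of "(\<eta> * ?\<rho>') powr c"] by (simp add: mult.assoc)
          finally show ?thesis .
        qed
        also have "\<kappa> * (\<eta> * ?\<rho>') powr c + (\<epsilon> * ?\<rho>') powr c = (\<eta> * ?\<rho>') powr c"
          using \<rho>' \<eta> \<epsilon> by (simp add: powr_mult \<epsilon>c \<kappa>_def field_simps)
        finally have "sum W (U h) \<le> (\<eta> * snd (last h)) powr c" using h by simp
        moreover have "\<forall>B\<in>set h. 0 < snd B"
          using pos[OF Suc.prems(1)] Suc.prems(2) by auto
        ultimately show ?case using good[of h] finU h \<rho>'(2) by simp
      }
    qed
    have "winning_strategy \<beta> S \<sigma>"
      unfolding winning_strategy_def
    proof (intro conjI allI impI)
      fix n B assume "legal_play_upto \<beta> \<sigma> n B"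
      from inv[OF this refl] show "alice_legal \<beta> (B n) (\<sigma> (map B [0..<Suc n]))"
        using \<beta> by (simp add: alice_legal_def good_def \<sigma>_def)
    next
      fix B assume B: "(\<forall>n. legal_play_upto \<beta> \<sigma> n B) \<and> (\<lambda>n. snd (B n)) \<longlonglongrightarrow> 0"
      have leg: "bob_legal \<beta> (B n) (\<sigma> (map B [0..<Suc n])) (B (Suc n))" for n
        using B unfolding legal_play_upto_def by blast
      have pos: "0 < snd (B n)" for n using inv[of n B] B by blast
      have "decseq (\<lambda>n. ball_set (B n))"
        using leg by (intro decseq_SucI) (auto simp: bob_legal_def)
      then have mono: "ball_set (B n) \<subseteq> ball_set (B k)" if "k \<le> n" for k n
        using that by (auto simp: decseq_def)
      have "\<Inter>(range (\<lambda>n. ball_set (B n))) \<noteq> {}"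
      proof (rule compact_nest)
        show "compact (ball_set (B n))" "ball_set (B n) \<noteq> {}" for n
          using pos[of n] by (auto simp: ball_set_def)
      qed (rule mono)
      then obtain z where z: "\<And>n. z \<in> ball_set (B n)" by blast
      have "z \<in> S"
      proof (rule win[OF pos _ _ z])
        show "\<beta> * snd (B n) \<le> snd (B (Suc n))" for n using leg[of n] by (simp add: bob_legal_def)
        show "(\<lambda>n. snd (B n)) \<longlonglongrightarrow> 0" using B by blast
        fix k M assume M: "M \<in> F (B k)"
        show "z \<notin> hyperplane_nbhd (fst M) (snd M)"
        proof
          assume zM: "z \<in> hyperplane_nbhd (fst M) (snd M)"
          have Mpos: "0 < snd M" using hyp[OF pos M] by simp
          have "snd M \<le> \<eta> * snd (B n)" if "k \<le> n" for n
          proof -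
            let ?h = "map B [0..<Suc n]"
            have "M \<in> U ?h" using M that zM z[of n] by (fastforce simp: U_def meets_def)
            moreover have "finite (U ?h)" "sum W (U ?h) \<le> (\<eta> * snd (B n)) powr c"
              using inv[of n B ?h] B by auto
            ultimately have "W M \<le> (\<eta> * snd (B n)) powr c"
              using member_le_sum[of M "U ?h" W] W0 by simp
            then show ?thesis using Mpos c(1) pos[of n] \<eta>
              powr_base_le_cancel[of "snd M" c "\<eta> * snd (B n)"] unfolding W_def by simp
          qed
          moreover have "(\<lambda>n. \<eta> * snd (B n)) \<longlonglongrightarrow> \<eta> * 0" using B by (intro tendsto_intros) auto
          ultimately have "snd M \<le> \<eta> * 0" by (intro LIMSEQ_le_const) auto
          then show False using Mpos by simp
        qed
      qed
      then show "(\<Inter>n. ball_set (B n)) \<inter> S \<noteq> {}" using z by blast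
    qed
    then show "beta_HAW \<beta> S" by (auto simp: beta_HAW_def)
  qed
qed

section \<open>Hausdorff dimension in the plane\<close>

lemma hausdorff_premeasure_null_Union:
  fixes A :: "nat \<Rightarrow> 'a::metric_space set"
  assumes "\<And>k. hausdorff_premeasure s \<delta> (A k) = 0"
  shows "hausdorff_premeasure s \<delta> (\<Union>k. A k) = 0"
proof -
  have "hausdorff_premeasure s \<delta> (\<Union>k. A k) \<le> 0 + ennreal \<epsilon>" if \<epsilon>: "0 < \<epsilon>" for \<epsilon> :: real
  proof -
    have "\<exists>U. A k \<subseteq> (\<Union>i. U i) \<and> (\<forall>i. bounded (U i) \<and> diameter (U i) \<le> \<delta>) \<and>
             (\<Sum>i. diameter_power s (U i)) < ennreal (\<epsilon> * (1/2) ^ Suc k)" for k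
    proof -
      have "hausdorff_premeasure s \<delta> (A k) < ennreal (\<epsilon> * (1/2) ^ Suc k)" using assms \<epsilon> by simp
      then show ?thesis unfolding hausdorff_premeasure_def INF_less_iff by blast
    qed
    then obtain U where U: "\<And>k. A k \<subseteq> (\<Union>i. U k i)" "\<And>k i. bounded (U k i) \<and> diameter (U k i) \<le> \<delta>"
       "\<And>k. (\<Sum>i. diameter_power s (U k i)) < ennreal (\<epsilon> * (1/2) ^ Suc k)"
      by metis
    define V where "V n = case_prod U (prod_decode n)" for n
    have "(\<Union>k. A k) \<subseteq> (\<Union>n. V n)"
    proof
      fix x assume "x \<in> (\<Union>k. A k)"
      then obtain k i where "x \<in> U k i" using U(1) by blast
      then have "x \<in> V (prod_encode (k, i))" by (simp add: V_def)
      then show "x \<in> (\<Union>n. V n)" by blast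
    qed
    moreover have "bounded (V n) \<and> diameter (V n) \<le> \<delta>" for n
      using U(2) by (simp add: V_def split: prod.split)
    ultimately have "hausdorff_premeasure s \<delta> (\<Union>k. A k) \<le> (\<Sum>n. diameter_power s (V n))"
      unfolding hausdorff_premeasure_def by (intro INF_lower) auto
    also have "(\<Sum>n. diameter_power s (V n)) =
        (\<Sum>n. (\<lambda>p. diameter_power s (case_prod U p)) (prod_decode n))" by (simp add: V_def)
    also have "\<dots> = (\<Sum>k. \<Sum>i. diameter_power s (U k i))"
      by (rule suminf_ennreal_2dimen) simp
    also have "\<dots> \<le> (\<Sum>k. ennreal (\<epsilon> * (1/2) ^ Suc k))"
      using U(3) by (intro suminf_le) (auto simp: less_imp_le)
    also have "\<dots> = ennreal \<epsilon>"
    proof (rule suminf_ennreal_eq)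
      show "(\<lambda>k. \<epsilon> * (1/2) ^ Suc k) sums \<epsilon>"
        using sums_mult[OF power_half_series, of \<epsilon>] by simp
    qed (use \<epsilon> in auto)
    finally show ?thesis by simp
  qed
  then have "hausdorff_premeasure s \<delta> (\<Union>k. A k) \<le> 0" by (rule ennreal_le_epsilon)
  then show ?thesis by simp
qed

text \<open>Cutting into n^2 squares of diameter at most 4R/n gives total weight at most (4R)^s
  n^(2-s), which tends to 0 for s > 2.\<close>

lemma hausdorff_premeasure_square_null:
  fixes s \<delta> R :: real
  assumes s: "2 < s" and \<delta>: "0 < \<delta>" and R: "0 < R"
  shows "hausdorff_premeasure s \<delta> ({-R..R} \<times> {-R..R}) = 0"
proof -
  have "hausdorff_premeasure s \<delta> ({-R..R} \<times> {-R..R}) \<le> 0 + ennreal \<epsilon>" if \<epsilon>: "0 < \<epsilon>" for \<epsilon> :: real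
  proof -
    have "((\<lambda>n. (4 * R) powr s * real n powr (2 - s)) \<longlongrightarrow> (4 * R) powr s * 0) sequentially"
      using s by (intro tendsto_intros tendsto_neg_powr filterlim_real_sequentially) auto
    then have "\<forall>\<^sub>F n in sequentially. (4 * R) powr s * real n powr (2 - s) < \<epsilon>"
      using \<epsilon> by (intro order_tendstoD(2)[where y = "(4 * R) powr s * 0"]) auto
    moreover have "((\<lambda>n. 4 * R / real n) \<longlongrightarrow> 0) sequentially"
      by (intro tendsto_divide_0[OF tendsto_const] filterlim_at_top_imp_at_infinity filterlim_real_sequentially)
    then have "\<forall>\<^sub>F n in sequentially. 4 * R / real n < \<delta>"
      using \<delta> by (rule order_tendstoD(2))
    ultimately have "\<forall>\<^sub>F n in sequentially. (4 * R) powr s * real n powr (2 - s) < \<epsilon> \<and> 4 * R / real n < \<delta> \<and> n > 0"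
      using eventually_gt_at_top[of 0] by eventually_elim auto
    then obtain n :: nat where n: "(4 * R) powr s * real n powr (2 - s) < \<epsilon>" "4 * R / real n < \<delta>" "n > 0"
      by (auto simp: eventually_sequentially)
    define I where "I i = {- R + 2 * R * real i / n .. - R + 2 * R * (real i + 1) / n}" for i :: nat
    define U where "U j = (if j < n * n then I (j div n) \<times> I (j mod n) else {})" for j
    have len: "\<bar>u - v\<bar> \<le> 2 * R / n" if "u \<in> I i" "v \<in> I i" for u v i
      using that n(3) by (auto simp: I_def abs_le_iff add_divide_distrib distrib_left)
    have dd: "dist p q \<le> 4 * R / n" if "p \<in> U j" "q \<in> U j" for p q j
    proof -
      obtain a b c d where pq: "p = (a, b)" "q = (c, d)" by fastforce
      have "dist p q \<le> norm (a - c) + norm (b - d)"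
        unfolding pq dist_norm using norm_Pair_le[of "a - c" "b - d"] by simp
      also have "\<dots> \<le> 2 * R / n + 2 * R / n"
        using that len pq by (intro add_mono) (auto simp: U_def split: if_splits)
      finally show ?thesis by simp
    qed
    have bd: "bounded (U j)" for j
      unfolding bounded_two_points using dd by blast
    have dU: "diameter (U j) \<le> 4 * R / n" for j
      using dd R n by (intro diameter_le) (auto simp: dist_norm)
    have dU': "diameter (U j) \<le> \<delta>" for j using dU[of j] n(2) by linarith
    have cov: "\<exists>i<n. u \<in> I i" if "u \<in> {-R..R}" for u
    \<comment> \<open>At the right endpoint the floor used below would give the index n, which is
      out of range.\<close>
    proof (cases "u = R")
      case True
      then show ?thesis using n(3) R
        by (intro exI[of _ "n - 1"]) (auto simp: I_def of_nat_diff field_simps)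
    next
      case False
      define w where "w = (u + R) / (2 * R)"
      have w: "0 \<le> w" "w < 1" "u = - R + 2 * R * w" using that False R by (auto simp: w_def field_simps)
      let ?t = "w * real n"
      have t: "0 \<le> ?t" "?t < n" using w n(3) by auto
      let ?i = "nat \<lfloor>?t\<rfloor>"
      have i: "real ?i \<le> ?t" "?t < real ?i + 1" using t(1) by linarith+
      have "u = - R + 2 * R * ?t / n" using w(3) n(3) by simp
      moreover have "2 * R * real ?i / n \<le> 2 * R * ?t / n" "2 * R * ?t / n \<le> 2 * R * (real ?i + 1) / n"
        by (rule divide_right_mono mult_left_mono | use i R in simp)+
      ultimately have "u \<in> I ?i" unfolding I_def by auto
      moreover have "?i < n" using t i(1) by linarith
      ultimately show ?thesis by blast
    qed
    have "{-R..R} \<times> {-R..R} \<subseteq> (\<Union>j. U j)"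
    proof
      fix p assume p: "p \<in> {-R..R} \<times> {-R..R}"
      obtain i j where ij: "i < n" "fst p \<in> I i" "j < n" "snd p \<in> I j"
        using cov[of "fst p"] cov[of "snd p"] p by (metis mem_Times_iff)
      have "i * n + j < n * n"
      proof -
        have "i * n + j < (i + 1) * n" using ij by simp
        also have "\<dots> \<le> n * n" using ij by (intro mult_right_mono) auto
        finally show ?thesis .
      qed
      then have "p \<in> U (i * n + j)" using ij by (simp add: U_def mem_Times_iff)
      then show "p \<in> (\<Union>j. U j)" by blast
    qed
    then have "hausdorff_premeasure s \<delta> ({-R..R} \<times> {-R..R}) \<le> (\<Sum>j. diameter_power s (U j))"
      unfolding hausdorff_premeasure_def using bd dU'
      by (intro INF_lower) auto
    also have "\<dots> = (\<Sum>j<n*n. diameter_power s (U j))"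
      by (intro suminf_finite) (auto simp: U_def diameter_power_def)
    also have "\<dots> \<le> (\<Sum>j<n*n. ennreal ((4 * R / n) powr s))"
    proof (rule sum_mono)
      fix j
      have "diameter (U j) powr s \<le> (4 * R / n) powr s"
        using dU s by (intro powr_mono2 diameter_ge_0 bd) auto
      then show "diameter_power s (U j) \<le> ennreal ((4 * R / n) powr s)"
        using s by (auto simp: diameter_power_def intro: ennreal_leI)
    qed
    also have "\<dots> = ennreal (real (n * n) * (4 * R / n) powr s)"
      by (simp add: ennreal_mult ennreal_of_nat_eq_real_of_nat)
    also have "real (n * n) * (4 * R / n) powr s = (4 * R) powr s * real n powr (2 - s)"
      using n(3) R by (simp add: powr_diff powr_divide power2_eq_square)
    also have "ennreal \<dots> \<le> ennreal \<epsilon>" using n(1) by (intro ennreal_leI) simp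
    finally show ?thesis by simp
  qed
  then have "hausdorff_premeasure s \<delta> ({-R..R} \<times> {-R..R}) \<le> 0" by (rule ennreal_le_epsilon)
  then show ?thesis by simp
qed

lemma hausdorff_premeasure_mono:
  "A \<subseteq> B \<Longrightarrow> hausdorff_premeasure s \<delta> A \<le> hausdorff_premeasure s \<delta> B"
  unfolding hausdorff_premeasure_def by (intro INF_superset_mono) auto

lemma hausdorff_dim_plane_le:
  fixes A :: "(real \<times> real) set"
  shows "hausdorff_dim A \<le> 2"
proof -
  have null: "hausdorff_measure s A = 0" if s: "2 < s" for s
  proof -
    have "hausdorff_premeasure s \<delta> A = 0" if \<delta>: "0 < \<delta>" for \<delta>
    proof -
      have "A \<subseteq> (\<Union>k. {- real (Suc k)..real (Suc k)} \<times> {- real (Suc k)..real (Suc k)})" (is "_ \<subseteq> ?B")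
      proof
        fix p assume "p \<in> A"
        obtain k :: nat where k: "max \<bar>fst p\<bar> \<bar>snd p\<bar> < real k" using reals_Archimedean2 by blast
        then have "p \<in> {- real (Suc k)..real (Suc k)} \<times> {- real (Suc k)..real (Suc k)}"
          by (auto simp: mem_Times_iff)
        then show "p \<in> ?B" by blast
      qed
      then have "hausdorff_premeasure s \<delta> A \<le> hausdorff_premeasure s \<delta> ?B"
        by (rule hausdorff_premeasure_mono)
      also have "\<dots> = 0"
        by (intro hausdorff_premeasure_null_Union hausdorff_premeasure_square_null s \<delta>) simp
      finally show ?thesis by simp
    qed
    then show ?thesis by (simp add: hausdorff_measure_def)
  qed
  have "hausdorff_dim A \<le> 2 + ennreal e" if "0 < e" for e
  proof -
    have "hausdorff_dim A \<le> ennreal (2 + e)"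
      unfolding hausdorff_dim_def using null[of "2 + e"] that by (intro INF_lower) auto
    then show ?thesis using that by (simp add: ennreal_plus)
  qed
  then show ?thesis by (rule ennreal_le_epsilon)
qed

section \<open>Lower bound for the dimension of winning sets\<close>

lemma infdist_hyperplane_ge:
  fixes a z :: "'a::euclidean_space"
  assumes a: "a \<noteq> 0"
  shows "\<bar>a \<bullet> z - b\<bar> / norm a \<le> infdist z {z. a \<bullet> z = b}"
proof -
  have ne: "(b / (a \<bullet> a)) *\<^sub>R a \<in> {z. a \<bullet> z = b}" using a by simp
  show ?thesis
    unfolding infdist_notempty[OF ex_in_conv[THEN iffD1, OF exI, OF ne]]
  proof (rule cINF_greatest)
    show "{z. a \<bullet> z = b} \<noteq> {}" using ne by blast
    fix w assume "w \<in> {z. a \<bullet> z = b}"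
    then have "\<bar>a \<bullet> z - b\<bar> = \<bar>a \<bullet> (z - w)\<bar>" by (simp add: inner_diff_right)
    also have "\<dots> \<le> norm a * dist z w" by (simp add: dist_norm Cauchy_Schwarz_ineq2)
    finally show "\<bar>a \<bullet> z - b\<bar> / norm a \<le> dist z w" using a by (simp add: field_simps)
  qed
qed

text \<open>Bob's choices: the side of the hyperplane containing the larger part of the ball contains
  a ball of a quarter of the radius, and in it a grid of well separated balls.\<close>

lemma bob_grid:
  fixes x :: "real \<times> real" and n :: nat
  assumes M: "alice_legal \<beta> (x, \<rho>) M" and \<rho>: "0 < \<rho>" and n: "2 \<le> n" and \<beta>: "\<beta> = 1 / (64 * real n)"
  obtains y where
    "\<And>i j :: nat. i \<le> n \<Longrightarrow> j \<le> n \<Longrightarrow>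
       bob_legal \<beta> (x, \<rho>) M (y + (4 * \<beta> * \<rho>) *\<^sub>R (real i, real j), \<beta> * \<rho>)"
proof -
  \<comment> \<open>The factor 64: n steps of 4\<beta>\<rho> span \<rho>/16 in each coordinate, so
    all centres are within \<rho>/8 of y and all balls within \<rho>/4, while y has distance at
    least \<rho>/2 from the hyperplane.\<close>
  have \<beta>0: "0 < \<beta>" and \<beta>1: "\<beta> \<le> 1 / 128" and n\<beta>: "n * \<beta> = 1 / 64" using n by (auto simp: \<beta> field_simps)
  obtain a b where a: "a \<noteq> 0" "fst M = {z. a \<bullet> z = b}" and r: "snd M \<le> \<beta> * \<rho>"
    using M by (auto simp: alice_legal_def affine_hyperplane_def)
  define e where "e = (if 0 \<le> a \<bullet> x - b then 1 else - 1 :: real)"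
  define y where "y = x + (e * \<rho> / 2 / norm a) *\<^sub>R a"
  have "a \<bullet> y - b = (a \<bullet> x - b) + e * (\<rho> / 2 * norm a)"
    using a by (simp add: y_def inner_add_right power2_norm_eq_inner[symmetric] power2_eq_square)
  moreover have "0 \<le> \<rho> / 2 * norm a" using \<rho> by simp
  ultimately have ay: "\<rho> / 2 * norm a \<le> \<bar>a \<bullet> y - b\<bar>" by (auto simp: e_def)
  have xy: "dist x y \<le> \<rho> / 2" using a \<rho> by (simp add: y_def dist_norm e_def)
  have far: "z \<in> cball x \<rho> - hyperplane_nbhd (fst M) (snd M)" if z: "dist y z \<le> \<rho> / 4" for z
  proof
    show "z \<in> cball x \<rho>" using dist_triangle[of x z y] xy z \<rho> by simp
    have "\<bar>a \<bullet> y - b\<bar> / norm a \<le> infdist y (fst M)" unfolding a(2) by (rule infdist_hyperplane_ge[OF a(1)])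
    moreover have "\<rho> / 2 \<le> \<bar>a \<bullet> y - b\<bar> / norm a" using ay a(1) by (simp add: pos_le_divide_eq)
    ultimately have "\<rho> / 2 \<le> infdist y (fst M)" by linarith
    also have "\<dots> \<le> infdist z (fst M) + dist y z" by (rule infdist_triangle)
    finally have "\<rho> / 4 \<le> infdist z (fst M)" using z by simp
    moreover have "\<beta> * \<rho> < \<rho> / 4" using \<beta>1 \<rho> mult_right_mono[OF \<beta>1, of \<rho>] by simp
    ultimately show "z \<notin> hyperplane_nbhd (fst M) (snd M)" using r by (simp add: hyperplane_nbhd_def)
  qed
  show ?thesis
  proof (rule that)
    fix i j :: nat assume ij: "i \<le> n" "j \<le> n"
    let ?c = "y + (4 * \<beta> * \<rho>) *\<^sub>R (real i, real j)"
    have "norm (real i, real j) \<le> real i + real j" using norm_Pair_le[of "real i" "real j"] by simp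
    also have "\<dots> \<le> 2 * n" using ij by simp
    finally have "norm ((4 * \<beta> * \<rho>) *\<^sub>R (real i, real j)) \<le> 4 * \<beta> * \<rho> * (2 * n)"
      using \<beta>0 \<rho> unfolding norm_scaleR by (intro mult_mono) auto
    also have "\<dots> = 8 * (n * \<beta>) * \<rho>" by simp
    finally have "dist y ?c \<le> \<rho> / 8" unfolding n\<beta> dist_commute[of y] by (simp add: dist_norm)
    moreover have "\<beta> * \<rho> \<le> \<rho> / 8" using \<rho> mult_right_mono[OF \<beta>1, of \<rho>] by simp
    ultimately have "dist y z \<le> \<rho> / 4" if "z \<in> cball ?c (\<beta> * \<rho>)" for z
      using dist_triangle[of y z ?c] that by simp
    then have "cball ?c (\<beta> * \<rho>) \<subseteq> cball x \<rho> - hyperplane_nbhd (fst M) (snd M)" using far by blast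
    then show "bob_legal \<beta> (x, \<rho>) M (?c, \<beta> * \<rho>)" using \<beta>0 \<rho> by (simp add: bob_legal_def ball_set_def)
  qed
qed

lemma grid_balls_separated:
  fixes y :: "real \<times> real"
  assumes d: "0 < d" and p: "p \<in> cball (y + (4 * d) *\<^sub>R (real i, real j)) d"
    and q: "q \<in> cball (y + (4 * d) *\<^sub>R (real i', real j')) d" and pq: "dist p q \<le> d"
  shows "i = i' \<and> j = j'"
proof -
  let ?c = "\<lambda>i j. y + (4 * d) *\<^sub>R (real i, real j)"
  have "dist (?c i j) (?c i' j') \<le> dist (?c i j) p + dist p q + dist q (?c i' j')"
    using dist_triangle[of "?c i j" "?c i' j'" p] dist_triangle[of p "?c i' j'" q] by linarith
  also have "\<dots> \<le> 3 * d" using p q pq by (simp add: dist_commute)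
  finally have le: "dist (?c i j) (?c i' j') \<le> 3 * d" .
  have 1: "4 * d * \<bar>real i - real i'\<bar> \<le> 3 * d"
    using order_trans[OF dist_fst_le le] d by (simp add: dist_norm abs_mult right_diff_distrib[symmetric])
  have 2: "4 * d * \<bar>real j - real j'\<bar> \<le> 3 * d"
    using order_trans[OF dist_snd_le le] d by (simp add: dist_norm abs_mult right_diff_distrib[symmetric])
  have "\<bar>real i - real i'\<bar> < 1" "\<bar>real j - real j'\<bar> < 1" using 1 2 d by (auto simp: field_simps)
  then show ?thesis by linarith
qed

text \<open>Bob avoids a given countable cover: the weight of the covering sets that meet his ball is
  at most \<open>(\<beta>\<rho>)\<^sup>s\<close>, so each of them meets at most one ball of the grid.\<close>

lemma winning_strategy_not_covered:
  fixes \<sigma> :: "(real \<times> real) alice_strategy" and n :: nat and U :: "nat \<Rightarrow> (real \<times> real) set"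
  assumes win: "winning_strategy \<beta> S \<sigma>" and n: "2 \<le> n" and \<beta>: "\<beta> = 1 / (64 * real n)"
    and s: "0 < s" and ns: "(64 * real n) powr s \<le> (real n + 1)\<^sup>2"
    and W: "\<And>i. 0 < W i" "summable W" "suminf W \<le> \<beta> powr s"
    and UW: "\<And>i p q. p \<in> U i \<Longrightarrow> q \<in> U i \<Longrightarrow> dist p q \<le> W i powr (1 / s)"
  shows "\<not> S \<subseteq> (\<Union>i. U i)"
proof
  assume cover: "S \<subseteq> (\<Union>i. U i)"
  have \<beta>0: "0 < \<beta>" "\<beta> < 1" using n by (auto simp: \<beta> field_simps)
  define w where "w B i = (if U i \<inter> ball_set B \<noteq> {} then W i else 0)" for B i
  define \<phi> where "\<phi> B = suminf (w B)" for B
  have w0: "0 \<le> w B i" "w B i \<le> W i" for B i using W(1)[of i] by (auto simp: w_def)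
  have sw: "summable (w B)" for B by (rule summable_comparison_test_ev[OF _ W(2)]) (simp add: w0)
  have w\<phi>: "w B i \<le> \<phi> B" for B i
    unfolding \<phi>_def using sum_le_suminf[OF sw, of "{i}"] w0 by simp
  have step: "\<exists>B'. bob_legal \<beta> B M B' \<and> snd B' = \<beta> * snd B \<and> \<phi> B' \<le> (\<beta> * snd B') powr s"
    if B: "0 < snd B" "\<phi> B \<le> (\<beta> * snd B) powr s" and M: "alice_legal \<beta> B M" for B M
  proof -
    obtain x \<rho> where x: "B = (x, \<rho>)" by fastforce
    have \<rho>: "0 < \<rho>" using B(1) x by simp
    obtain y where y: "\<And>i j :: nat. i \<le> n \<Longrightarrow> j \<le> n \<Longrightarrow>
       bob_legal \<beta> (x, \<rho>) M (y + (4 * \<beta> * \<rho>) *\<^sub>R (real i, real j), \<beta> * \<rho>)"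
      using bob_grid[OF M[unfolded x] \<rho> n \<beta>] by blast
    define G where "G = (\<lambda>(i, j). (y + (4 * (\<beta> * \<rho>)) *\<^sub>R (real i, real j), \<beta> * \<rho>))"
    let ?J = "{..n} \<times> {..n}"
    have leg: "bob_legal \<beta> B M (G p)" if "p \<in> ?J" for p
      using y that x by (auto simp: G_def mult.assoc)
    have once: "(\<Sum>p\<in>?J. w (G p) i) \<le> w B i" for i
    proof (cases "\<exists>p\<in>?J. U i \<inter> ball_set (G p) \<noteq> {}")
      case False
      then have "(\<Sum>p\<in>?J. w (G p) i) = 0" by (intro sum.neutral) (auto simp: w_def)
      then show ?thesis using w0 by simp
    next
      case True
      then obtain p where p: "p \<in> ?J" "U i \<inter> ball_set (G p) \<noteq> {}" by blast
      have "ball_set (G p) \<subseteq> ball_set B" using leg[OF p(1)] by (auto simp: bob_legal_def)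
      then have wB: "w B i = W i" using p(2) by (auto simp: w_def)
      then have "W i \<le> (\<beta> * \<rho>) powr s" using w\<phi>[of B i] B(2) x by simp
      then have "W i powr (1 / s) \<le> ((\<beta> * \<rho>) powr s) powr (1 / s)"
        using s W(1)[of i] by (intro powr_mono2) auto
      also have "\<dots> = \<beta> * \<rho>" using s \<beta>0 \<rho> by (simp add: powr_powr)
      finally have d: "W i powr (1 / s) \<le> \<beta> * \<rho>" .
      have "q = p" if q: "q \<in> ?J" "U i \<inter> ball_set (G q) \<noteq> {}" for q
      proof -
        obtain u v where uv: "u \<in> U i" "u \<in> ball_set (G p)" "v \<in> U i" "v \<in> ball_set (G q)"
          using p(2) q(2) by blast
        have "dist u v \<le> \<beta> * \<rho>" using UW[OF uv(1,3)] d by linarith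
        then show ?thesis
          using grid_balls_separated[of "\<beta> * \<rho>" u y "fst p" "snd p" v "fst q" "snd q"] uv \<beta>0 \<rho>
          by (auto simp: G_def ball_set_def split: prod.splits)
      qed
      then have other: "U i \<inter> ball_set (G q) = {}" if "q \<in> ?J" "q \<noteq> p" for q using that by blast
      have "w (G q) i = (if q = p then W i else 0)" if "q \<in> ?J" for q
        using p(2) other[OF that] by (cases "q = p") (simp_all add: w_def)
      then have "(\<Sum>q\<in>?J. w (G q) i) = (\<Sum>q\<in>?J. if q = p then W i else 0)"
        by (rule sum.cong[OF refl])
      then show ?thesis using p(1) wB by simp
    qed
    have "(\<Sum>p\<in>?J. \<phi> (G p)) = (\<Sum>i. \<Sum>p\<in>?J. w (G p) i)"
      unfolding \<phi>_def using sw by (intro suminf_sum[symmetric]) auto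
    also have "\<dots> \<le> \<phi> B"
      unfolding \<phi>_def using once sw by (intro suminf_le summable_sum) auto
    finally have tot: "(\<Sum>p\<in>?J. \<phi> (G p)) \<le> \<phi> B" .
    have "\<exists>p\<in>?J. \<phi> (G p) \<le> \<phi> B / (real n + 1)\<^sup>2"
    proof (rule ccontr)
      assume "\<not> ?thesis"
      then have "(\<Sum>p\<in>?J. \<phi> B / (real n + 1)\<^sup>2) < (\<Sum>p\<in>?J. \<phi> (G p))"
        by (intro sum_strict_mono) (auto simp: not_le)
      moreover have "(\<Sum>p\<in>?J. \<phi> B / (real n + 1)\<^sup>2) = \<phi> B"
      proof -
        have "real (card ?J) = (real n + 1)\<^sup>2" by (simp add: power2_eq_square algebra_simps)
        moreover have "(real n + 1)\<^sup>2 \<noteq> 0" by simp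
        ultimately show ?thesis by (simp del: card_cartesian_product)
      qed
      ultimately show False using tot by simp
    qed
    then obtain p where p: "p \<in> ?J" "\<phi> (G p) \<le> \<phi> B / (real n + 1)\<^sup>2" by blast
    have G\<rho>: "snd (G p) = \<beta> * \<rho>" by (simp add: G_def split: prod.splits)
    \<comment> \<open>There are (n + 1)^2 balls in the grid, and \<open>ns\<close> says that this is
      at least \<beta>^-s. The lightest ball thus keeps at most the proportion \<beta>^s of the
      weight, exactly the decrease of (\<beta>\<rho>)^s in one move.\<close>
    have "1 / (real n + 1)\<^sup>2 \<le> 1 / (64 * real n) powr s"
      using ns n by (intro divide_left_mono) auto
    also have "\<dots> = \<beta> powr s" using n by (simp add: \<beta> powr_divide)
    finally have "\<phi> B * (1 / (real n + 1)\<^sup>2) \<le> (\<beta> * \<rho>) powr s * \<beta> powr s"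
      using B(2) x by (intro mult_mono) auto
    then have "\<phi> (G p) \<le> (\<beta> * snd (G p)) powr s"
      using p(2) G\<rho> \<beta>0 \<rho> by (simp add: powr_mult mult_ac)
    then show ?thesis using leg[OF p(1)] G\<rho> x by (intro exI[of _ "G p"]) simp
  qed
  define pick where "pick h = (SOME B'. bob_legal \<beta> (last h) (\<sigma> h) B' \<and> snd B' = \<beta> * snd (last h) \<and>
      \<phi> B' \<le> (\<beta> * snd B') powr s)" for h
  define hist where "hist = rec_nat [(0, 1)] (\<lambda>_ h. h @ [pick h])"
  have hist: "hist 0 = [(0, 1)]" "\<And>k. hist (Suc k) = hist k @ [pick (hist k)]"
    by (simp_all add: hist_def)
  define B where "B k = last (hist k)" for k
  have map: "map B [0..<Suc k] = hist k" for k
    by (induction k) (simp_all add: hist B_def)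
  have inv: "legal_play_upto \<beta> \<sigma> k B \<and> snd (B k) = \<beta> ^ k \<and> \<phi> (B k) \<le> (\<beta> * snd (B k)) powr s" for k
  proof (induction k)
    case 0
    have "\<phi> (B 0) \<le> suminf W" unfolding \<phi>_def using w0 sw W(2) by (intro suminf_le) auto
    then show ?case using W(3) by (simp add: legal_play_upto_def B_def hist)
  next
    case (Suc k)
    have "alice_legal \<beta> (B k) (\<sigma> (hist k))"
      using win Suc.IH map[of k] unfolding winning_strategy_def by metis
    moreover have "0 < snd (B k)" using Suc.IH \<beta>0 by simp
    ultimately have "\<exists>B'. bob_legal \<beta> (B k) (\<sigma> (hist k)) B' \<and> snd B' = \<beta> * snd (B k) \<and>
        \<phi> B' \<le> (\<beta> * snd B') powr s" using step Suc.IH by blast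
    then have "bob_legal \<beta> (B k) (\<sigma> (hist k)) (B (Suc k)) \<and> snd (B (Suc k)) = \<beta> * snd (B k) \<and>
        \<phi> (B (Suc k)) \<le> (\<beta> * snd (B (Suc k))) powr s"
      unfolding B_def hist last_snoc pick_def by (rule someI_ex)
    then show ?case using Suc.IH map[of k] by (auto simp: legal_play_upto_def less_Suc_eq)
  qed
  have "(\<lambda>k. snd (B k)) \<longlonglongrightarrow> 0" using inv \<beta>0 by (simp add: LIMSEQ_realpow_zero)
  then have "(\<Inter>k. ball_set (B k)) \<inter> S \<noteq> {}" using win inv unfolding winning_strategy_def by blast
  then obtain z where zz: "z \<in> (\<Inter>k. ball_set (B k))" "z \<in> S" by auto
  then have "z \<in> (\<Union>i. U i)" using cover by (auto dest: subsetD)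
  then obtain i where "z \<in> U i" by (rule UN_E)
  moreover have "z \<in> ball_set (B k)" for k using zz(1) by (rule INT_D) simp
  ultimately have z: "\<And>k. z \<in> ball_set (B k)" "z \<in> U i" by simp_all
  \<comment> \<open>A covering set that contains the outcome meets every ball, so its weight is
    bounded by a null sequence. This contradicts \<open>0 < W i\<close>.\<close>
  have "W i \<le> (\<beta> * \<beta> ^ k) powr s" for k
  proof -
    have "w (B k) i = W i" using z by (auto simp: w_def)
    then show ?thesis using w\<phi>[of "B k" i] inv[of k] by (metis order_trans)
  qed
  moreover have "(\<lambda>k. (\<beta> * \<beta> ^ k) powr s) \<longlonglongrightarrow> (\<beta> * 0) powr s"
    using \<beta>0 s by (intro tendsto_powr' tendsto_intros LIMSEQ_realpow_zero) auto
  ultimately have "W i \<le> (\<beta> * 0) powr s" by (intro LIMSEQ_le_const) auto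
  then show False using W(1)[of i] by simp
qed

theorem HAW_hausdorff_dim_ge:
  fixes S :: "(real \<times> real) set"
  assumes "HAW S"
  shows "2 \<le> hausdorff_dim S"
  unfolding hausdorff_dim_def
proof (rule INF_greatest)
  fix s assume "s \<in> {s. 0 \<le> s \<and> hausdorff_measure s S = 0}"
  then have s: "0 \<le> s" "hausdorff_measure s S = 0" by auto
  show "2 \<le> ennreal s"
  proof (rule ccontr)
    assume "\<not> 2 \<le> ennreal s"
    then have s2: "s < 2" by (metis ennreal_leI ennreal_numeral not_less)
    \<comment> \<open>Two reasons to enlarge s: it may be 0, where 1/s is meaningless, and t < 2
      lies above it, so (64n)^t \<le> (n + 1)^2 for large n. Since all diameters are at most 1,
      weights for t do not exceed those for s.\<close>
    define t where "t = (s + 2) / 2"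
    have t: "0 < t" "s < t" "t < 2" using s(1) s2 by (auto simp: t_def)
    have "((\<lambda>n. 64 powr t * real n powr (t - 2)) \<longlongrightarrow> 64 powr t * 0) sequentially"
      using t by (intro tendsto_intros tendsto_neg_powr filterlim_real_sequentially) auto
    then have "\<forall>\<^sub>F n in sequentially. 64 powr t * real n powr (t - 2) < 1"
      by (intro order_tendstoD(2)[where y = "64 powr t * 0"]) auto
    then have "\<forall>\<^sub>F n in sequentially. 64 powr t * real n powr (t - 2) < 1 \<and> 2 \<le> n"
      using eventually_ge_at_top[of 2] by eventually_elim auto
    then obtain n :: nat where n: "64 powr t * real n powr (t - 2) < 1" "2 \<le> n"
      by (auto simp: eventually_sequentially)
    have "(64 * real n) powr t = 64 powr t * real n powr (t - 2) * (real n)\<^sup>2"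
      using n(2) by (simp add: powr_mult powr_diff)
    also have "\<dots> \<le> 1 * (real n)\<^sup>2" using n(1) by (intro mult_right_mono) auto
    also have "\<dots> \<le> (real n + 1)\<^sup>2" by (simp add: power2_eq_square algebra_simps)
    finally have ns: "(64 * real n) powr t \<le> (real n + 1)\<^sup>2" .
    define \<beta> where "\<beta> = 1 / (64 * real n)"
    have \<beta>: "0 < \<beta>" "\<beta> < 1 / 3" using n(2) by (auto simp: \<beta>_def field_simps)
    obtain \<sigma> where \<sigma>: "winning_strategy \<beta> S \<sigma>" using assms \<beta> by (auto simp: HAW_def beta_HAW_def)
    define e where "e = \<beta> powr t / 2"
    have e: "0 < e" using \<beta> by (simp add: e_def)
    have "hausdorff_premeasure s 1 S \<le> hausdorff_measure s S"
      unfolding hausdorff_measure_def by (intro SUP_upper) auto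
    then have "hausdorff_premeasure s 1 S < ennreal e" using s(2) e by simp
    then obtain U where U: "S \<subseteq> (\<Union>i. U i)" "\<And>i. bounded (U i) \<and> diameter (U i) \<le> 1"
       "(\<Sum>i. diameter_power s (U i)) < ennreal e"
      unfolding hausdorff_premeasure_def INF_less_iff by blast
    define D where "D i = enn2real (diameter_power s (U i))" for i
    have D: "ennreal (D i) = diameter_power s (U i)" "0 \<le> D i" for i
      by (auto simp: D_def diameter_power_def)
    have sD: "(\<Sum>i. ennreal (D i)) < ennreal e" using U(3) D by simp
    have D2: "summable D" using D(2) sD by (intro summable_suminf_not_top) (auto simp: top_unique)
    have D3: "suminf D \<le> e"
      using sD suminf_ennreal2[OF D(2) D2] e by (simp add: ennreal_less_iff suminf_nonneg D D2)
    \<comment> \<open>The geometric term makes every weight positive, as Bob must also escape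
      covering sets of diameter 0. It takes the half of the budget \<beta>^t that \<open>e\<close>
      leaves.\<close>
    define W where "W i = D i + e * (1 / 2) ^ Suc i" for i
    have es: "(\<lambda>i. e * (1 / 2) ^ Suc i) sums e" using sums_mult[OF power_half_series, of e] by simp
    have "\<not> S \<subseteq> (\<Union>i. U i)"
    proof (rule winning_strategy_not_covered[OF \<sigma> n(2) \<beta>_def t(1) ns])
      show "0 < W i" for i using D(2)[of i] e by (simp add: W_def add_nonneg_pos)
      show "summable W" unfolding W_def using D2 es by (intro summable_add) (auto simp: sums_iff)
      have "suminf W = suminf D + e"
        unfolding W_def using suminf_add[OF D2, of "\<lambda>i. e * (1 / 2) ^ Suc i"] es by (simp add: sums_iff)
      then show "suminf W \<le> \<beta> powr t" using D3 by (simp add: e_def)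
      fix i p q assume pq: "p \<in> U i" "q \<in> U i"
      let ?d = "diameter (U i)"
      have d: "dist p q \<le> ?d" using diameter_bounded_bound U(2) pq by blast
      have d0: "0 \<le> ?d" using U(2) by (intro diameter_ge_0) auto
      have "?d powr t \<le> D i"
      proof (cases "s = 0")
        case True
        then have "D i = 1" using pq by (auto simp: D_def diameter_power_def)
        then show ?thesis using U(2)[of i] d0 t by (auto intro: powr_le1)
      next
        case False
        then have "D i = ?d powr s" using pq by (auto simp: D_def diameter_power_def)
        then show ?thesis using U(2)[of i] d0 t by (auto intro: powr_mono')
      qed
      also have "\<dots> \<le> W i" using e by (simp add: W_def)
      finally have "(?d powr t) powr (1 / t) \<le> W i powr (1 / t)" using t by (intro powr_mono2) auto
      then show "dist p q \<le> W i powr (1 / t)" using d d0 t by (simp add: powr_powr)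
    qed
    then show False using U(1) by blast
  qed
qed

section \<open>Rational points and lines of bounded height\<close>

text \<open>Coprimality of the triple in Bezout form: the proofs below multiply by the left-hand
  side of the Bezout identity.\<close>

definition primitive :: "int \<Rightarrow> int \<Rightarrow> int \<Rightarrow> bool"
  where "primitive a b c \<longleftrightarrow> (\<exists>u v w. u * a + v * b + w * c = 1)"

text \<open>A triple \<open>(q, p1, p2)\<close> stands for the rational point \<open>(p1/q, p2/q)\<close>, and
  \<open>(A, B, C)\<close> for the line \<open>A x + B y + C = 0\<close>.\<close>

definition rational_line :: "real \<Rightarrow> real \<Rightarrow> int \<times> int \<times> int \<Rightarrow> int \<times> int \<times> int \<Rightarrow> bool"
  where "rational_line a b P L \<longleftrightarrow> (case (P, L) of ((q, p1, p2), (A, B, C)) \<Rightarrow>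
     A * p1 + B * p2 + C * q = 0 \<and> primitive A B C \<and>
     a \<le> A \<and> A < 2 * a \<and> \<bar>real_of_int B\<bar> \<le> b \<and> \<bar>B\<bar> \<le> A)"

text \<open>The box for (A, B) makes |A| |q x - p1| and |B| |q y - p2| at most \<theta> sqrt(q/Q).
  Passing to the dyadic size 2^l of q, with \<epsilon> = \<theta> sqrt(2^l/Q), costs a factor 3/2 >
  sqrt 2, and b \<le> 2|B| costs another factor 2 in the second bound.\<close>

definition near_point :: "real \<Rightarrow> real \<Rightarrow> real \<Rightarrow> int \<times> int \<times> int \<Rightarrow> real \<times> real \<Rightarrow> bool"
  where "near_point \<epsilon> a b P z \<longleftrightarrow> (case (P, z) of ((q, p1, p2), (x, y)) \<Rightarrow>
     a * \<bar>q * x - p1\<bar> \<le> 3 / 2 * \<epsilon> \<and> b * \<bar>q * y - p2\<bar> \<le> 3 * \<epsilon>)"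

section \<open>Uniqueness of the line of a class\<close>

lemma primitive_eqI:
  assumes "primitive a b c" "primitive a' b' c'" "0 < a" "0 < a'" "a * b' = a' * b" "a * c' = a' * c"
  shows "a = a' \<and> b = b' \<and> c = c'"
proof -
  obtain u v w where 1: "u * a + v * b + w * c = 1" using assms(1) by (auto simp: primitive_def)
  obtain u' v' w' where 2: "u' * a' + v' * b' + w' * c' = 1" using assms(2) by (auto simp: primitive_def)
  have "a' = a' * (u * a + v * b + w * c)" using 1 by simp
  also have "\<dots> = a * (u * a' + v * b' + w * c')" using assms(5,6) by algebra
  finally have "a dvd a'" by (rule dvdI)
  have "a = a * (u' * a' + v' * b' + w' * c')" using 2 by simp
  also have "\<dots> = a' * (u' * a + v' * b + w' * c)" using assms(5,6) by algebra
  finally have "a' dvd a" by (rule dvdI)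
  with \<open>a dvd a'\<close> have "a = a'" using assms(3,4) zdvd_antisym_nonneg[of a a'] by simp
  then show ?thesis using assms by auto
qed

text \<open>Since the rational point is on the line, q (A x + B y + C) = A (q x - p1) + B (q y -
  p2). Each summand is at most 3\<theta>t, because A < 2a and |B| \<le> b.\<close>

lemma near_point_line_bound:
  assumes L: "rational_line a b (q, p1, p2) (A, B, C)" and P: "near_point (\<theta> * t) a b (q, p1, p2) (x, y)"
    and pos: "0 < \<theta>" "0 < t" "0 < Q" and q: "t\<^sup>2 * Q \<le> q"
  shows "\<bar>A * x + B * y + C\<bar> \<le> 6 * \<theta> / (t * Q)"
proof -
  have q0: "0 < real_of_int q" using q pos by (smt (verit) mult_pos_pos zero_less_power)
  have L': "A * p1 + B * p2 + C * q = 0" "0 \<le> real_of_int A" "real_of_int A \<le> 2 * a" "\<bar>real_of_int B\<bar> \<le> b"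
    using L by (auto simp: rational_line_def)
  have P': "a * \<bar>q * x - p1\<bar> \<le> 3 / 2 * (\<theta> * t)" "b * \<bar>q * y - p2\<bar> \<le> 3 * (\<theta> * t)"
    using P by (auto simp: near_point_def)
  have "real_of_int (A * p1 + B * p2 + C * q) = 0" using L'(1) by simp
  then have "q * (A * x + B * y + C) = A * (q * x - p1) + B * (q * y - p2)"
    by (simp add: algebra_simps)
  then have "q * \<bar>A * x + B * y + C\<bar> = \<bar>A * (q * x - p1) + B * (q * y - p2)\<bar>"
    using q0 by (metis abs_mult abs_of_pos)
  also have "\<dots> \<le> A * \<bar>q * x - p1\<bar> + \<bar>B\<bar> * \<bar>q * y - p2\<bar>"
    using abs_triangle_ineq[of "A * (q * x - p1)" "B * (q * y - p2)"] L'(2) by (simp add: abs_mult)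
  also have "\<dots> \<le> 2 * a * \<bar>q * x - p1\<bar> + b * \<bar>q * y - p2\<bar>"
    using L' by (intro add_mono mult_right_mono) auto
  also have "\<dots> \<le> 6 * (\<theta> * t)" using P' by simp
  finally have "\<bar>A * x + B * y + C\<bar> \<le> 6 * (\<theta> * t) / q" using q0 by (simp add: field_simps)
  also have "\<dots> \<le> 6 * (\<theta> * t) / (t\<^sup>2 * Q)" using q pos q0 by (intro divide_left_mono) auto
  also have "\<dots> = 6 * \<theta> / (t * Q)" using pos by (simp add: power2_eq_square)
  finally show ?thesis .
qed

text \<open>The cross product of two points of a primitive line is an integer multiple of that line,
  so it vanishes once its first entry is smaller than \<open>A\<close>.\<close>

lemma points_on_line_parallel:
  fixes q p1 p2 q' s1 s2 A B C :: int
  assumes L: "A * p1 + B * p2 + C * q = 0" "A * s1 + B * s2 + C * q' = 0" "primitive A B C" "0 < A"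
    and small: "\<bar>p2 * q' - q * s2\<bar> < A"
  shows "q * s1 = q' * p1" "q * s2 = q' * p2"
proof -
  obtain u v w where 1: "u * A + v * B + w * C = 1" using L(3) by (auto simp: primitive_def)
  define N1 N2 N3 where "N1 = p2 * q' - q * s2" and "N2 = q * s1 - p1 * q'" and "N3 = p1 * s2 - p2 * s1"
  define k where "k = u * N1 + v * N2 + w * N3"
  have "N1 * B = A * N2" "N1 * C = A * N3" "N2 * C = B * N3"
    unfolding N1_def N2_def N3_def using L(1,2) by algebra+
  then have N: "N1 * (u * A + v * B + w * C) = A * k" "N2 * (u * A + v * B + w * C) = B * k"
    unfolding k_def by algebra+
  then have "\<bar>A * k\<bar> < A" using small 1 by (simp add: N1_def)
  then have "k = 0" using L(4) by (cases "k = 0") (auto simp: abs_mult mult_less_cancel_left2)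
  then have "N1 = 0" "N2 = 0" using N unfolding 1 by simp_all
  then show "q * s1 = q' * p1" "q * s2 = q' * p2" by (simp_all add: N1_def N2_def algebra_simps)
qed

text \<open>The cross product entry equals q (q' y - s2) - q' (q y - p2). In units of
  a\<Omega>\<theta>t the first term contributes at most 2 4 54 = 432 and the second at most 4 3 =
  12, hence 444.\<close>

lemma cross_first_small:
  fixes q p2 q' s2 A :: int and a b D \<Omega> \<theta> t Q y :: real
  assumes near: "b * \<bar>q * y - p2\<bar> \<le> 3 * (\<theta> * t)" and s2: "\<bar>q' * y - s2\<bar> \<le> 4 * a * D"
    and q': "\<bar>real_of_int q'\<bar> \<le> 4 * a * b" and q: "0 < q" "q < 2 * (t\<^sup>2 * Q)"
    and D: "D = 54 * \<Omega> * \<theta> / (t * Q)" and \<Omega>: "1 \<le> \<Omega>" and pos: "0 < \<theta>" "0 < t" "0 < Q" "0 < a"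
    and A: "a \<le> A" and lt: "444 * \<Omega> * \<theta> * t < 1"
  shows "\<bar>p2 * q' - q * s2\<bar> < A"
proof -
  have "\<bar>p2 * q' - q * s2\<bar> = \<bar>q * (q' * y - s2) - q' * (q * y - p2)\<bar>" by (simp add: algebra_simps)
  also have "\<dots> \<le> q * \<bar>q' * y - s2\<bar> + \<bar>q'\<bar> * \<bar>q * y - p2\<bar>"
    using abs_triangle_ineq4[of "q * (q' * y - s2)" "q' * (q * y - p2)"] q(1) by (simp add: abs_mult)
  also have "\<dots> \<le> 2 * (t\<^sup>2 * Q) * (4 * a * D) + 4 * a * b * \<bar>q * y - p2\<bar>"
  proof (intro add_mono mult_mono mult_right_mono)
    show "0 \<le> 2 * (t\<^sup>2 * Q)" using q by linarith
  qed (use q s2 q' in auto)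
  also have "4 * a * b * \<bar>q * y - p2\<bar> \<le> 4 * a * (3 * (\<theta> * t))"
    using near pos by (simp add: mult.assoc)
  also have "2 * (t\<^sup>2 * Q) * (4 * a * D) = 432 * \<Omega> * (a * \<theta> * t)"
    using pos by (simp add: D power2_eq_square field_simps)
  also have "4 * a * (3 * (\<theta> * t)) \<le> 12 * \<Omega> * (a * \<theta> * t)"
    using \<Omega> pos mult_right_mono[OF \<Omega>, of "12 * (a * \<theta> * t)"] by (simp add: algebra_simps)
  also have "432 * \<Omega> * (a * \<theta> * t) + 12 * \<Omega> * (a * \<theta> * t) = a * (444 * \<Omega> * \<theta> * t)"
    by (simp add: algebra_simps)
  also have "\<dots> < a * 1" using lt pos by (intro mult_strict_left_mono) auto
  finally show ?thesis using A by linarith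
qed

text \<open>With \<open>D\<close> the bound for the two forms on the ball, the intersection \<open>P' = (s1/n, s2/n)\<close> of two
  distinct lines satisfies \<open>|n x - s1| \<le> 2 b D\<close> and \<open>|n y - s2| \<le> 4 a D\<close>. If \<open>444 \<Omega> \<theta> t < 1\<close>, both given
  points coincide with \<open>P'\<close>; otherwise \<open>n\<close> is so small compared to \<open>t\<^sup>2Q\<close> that \<open>P'\<close>
  contradicts the assumption on smaller denominators. Here \<open>t\<^sup>2Q\<close> is the dyadic size of \<open>q\<close>.\<close>

lemma unique_line:
  fixes \<theta> \<omega> g t Q a b bb \<rho> x y x' y' :: real
  assumes pos: "0 < \<theta>" "0 < t" "0 < Q" "1 \<le> \<omega>" "1 \<le> g" "1 \<le> a" "1 \<le> bb" "0 \<le> b" "b \<le> bb / 2"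
    and g: "g ^ 4 * (a * bb) = 8 * Q" and \<theta>: "\<theta> * \<omega>\<^sup>2 = 1 / 200000"
    and \<rho>: "\<rho> \<le> \<omega> * g * (6 * \<theta> / (a * t * Q))" "\<bar>x - x'\<bar> \<le> 2 * \<rho>" "\<bar>y - y'\<bar> \<le> 2 * \<rho>"
    and P: "primitive q p1 p2" "t\<^sup>2 * Q \<le> q" "q < 2 * (t\<^sup>2 * Q)"
    and P': "primitive q' p1' p2'" "t\<^sup>2 * Q \<le> q'" "q' < 2 * (t\<^sup>2 * Q)"
    and L: "rational_line a b (q, p1, p2) (A, B, C)"
    and L': "rational_line a b (q', p1', p2') (A', B', C')"
    and near: "near_point (\<theta> * t) a b (q, p1, p2) (x, y)"
    and near': "near_point (\<theta> * t) a b (q', p1', p2') (x', y')"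
    and good: "\<And>(n::int) (m1::int) (m2::int). 0 < n \<Longrightarrow> n < t\<^sup>2 * Q \<Longrightarrow> \<theta>\<^sup>2 / Q < \<bar>n * x - m1\<bar> * \<bar>n * y - m2\<bar>"
    and ne: "(A, B, C) \<noteq> (A', B', C')"
  shows "(q, p1, p2) = (q', p1', p2')"
proof -
  define \<Omega> where "\<Omega> = \<omega> * g"
  have \<Omega>: "1 \<le> \<Omega>" using pos by (simp add: \<Omega>_def mult_ge1_I)
  \<comment> \<open>54 = 6 + 48: the value of a form at its own near point is at most
    6\<theta>/(tQ), and moving by 2\<rho> in both coordinates with coefficients up to 2a adds
    8a\<rho> \<le> 48\<Omega>\<theta>/(tQ).\<close>
  define D where "D = 54 * \<Omega> * \<theta> / (t * Q)"
  have D0: "0 < D" using pos \<Omega> by (simp add: D_def)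
  have lin: "A * p1 + B * p2 + C * q = 0" "primitive A B C" "a \<le> A" "A < 2 * a" "\<bar>real_of_int B\<bar> \<le> b"
     "\<bar>real_of_int B\<bar> \<le> A" using L by (auto simp: rational_line_def)
  have lin': "A' * p1' + B' * p2' + C' * q' = 0" "primitive A' B' C'" "a \<le> A'" "A' < 2 * a" "\<bar>real_of_int B'\<bar> \<le> b"
     "\<bar>real_of_int B'\<bar> \<le> A'" using L' by (auto simp: rational_line_def)
  have A0: "0 < A" "0 < A'" using lin lin' pos by linarith+
  have AB: "\<bar>real_of_int A\<bar> \<le> 2 * a" "\<bar>real_of_int A'\<bar> \<le> 2 * a" "\<bar>real_of_int B\<bar> \<le> 2 * a" "\<bar>real_of_int B'\<bar> \<le> 2 * a"
    using lin lin' A0 by linarith+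
  have tQ: "0 < t\<^sup>2 * Q" using pos by simp
  have q0: "0 < q" "0 < q'" using P P' tQ by linarith+
  have D9: "6 * \<theta> / (t * Q) + 8 * a * \<rho> \<le> D"
  proof -
    have "8 * a * \<rho> \<le> 8 * a * (\<omega> * g * (6 * \<theta> / (a * t * Q)))"
      using \<rho>(1) pos by (intro mult_left_mono) auto
    also have "\<dots> = 48 * \<Omega> * \<theta> / (t * Q)" using pos by (simp add: \<Omega>_def)
    finally have "8 * a * \<rho> \<le> 48 * \<Omega> * \<theta> / (t * Q)" .
    moreover have "6 * \<theta> / (t * Q) \<le> 6 * \<Omega> * \<theta> / (t * Q)" using \<Omega> pos by (intro divide_right_mono) auto
    moreover have "D = 48 * \<Omega> * \<theta> / (t * Q) + 6 * \<Omega> * \<theta> / (t * Q)"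
      unfolding D_def add_divide_distrib[symmetric] by simp
    ultimately show ?thesis by linarith
  qed
  have shift: "\<bar>A * u + B * v + C\<bar> \<le> D"
    if l: "\<bar>A * u' + B * v' + C\<bar> \<le> 6 * \<theta> / (t * Q)" and uv: "\<bar>u - u'\<bar> \<le> 2 * \<rho>" "\<bar>v - v'\<bar> \<le> 2 * \<rho>"
     and A: "\<bar>A\<bar> \<le> 2 * a" "\<bar>B\<bar> \<le> 2 * a" for A B C u v u' v' :: real
  proof -
    have "A * u + B * v + C = (A * u' + B * v' + C) + (A * (u - u') + B * (v - v'))" by (simp add: algebra_simps)
    then have "\<bar>A * u + B * v + C\<bar> \<le> \<bar>A * u' + B * v' + C\<bar> + (\<bar>A\<bar> * \<bar>u - u'\<bar> + \<bar>B\<bar> * \<bar>v - v'\<bar>)"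
      using abs_triangle_ineq[of "A * (u - u')" "B * (v - v')"] unfolding abs_mult by linarith
    also have "\<dots> \<le> 6 * \<theta> / (t * Q) + (2 * a * (2 * \<rho>) + 2 * a * (2 * \<rho>))"
      by (intro add_mono mult_mono l uv A abs_ge_zero) (use pos in simp_all)
    finally show ?thesis using D9 by (simp add: mult_ac)
  qed
  have \<rho>0: "0 \<le> \<rho>" using \<rho>(2) by linarith
  have lb: "\<bar>A * x + B * y + C\<bar> \<le> 6 * \<theta> / (t * Q)" "\<bar>A' * x' + B' * y' + C'\<bar> \<le> 6 * \<theta> / (t * Q)"
    using near_point_line_bound[OF L near pos(1-3) P(2)] near_point_line_bound[OF L' near' pos(1-3) P'(2)] .
  have at_z: "\<bar>A * x + B * y + C\<bar> \<le> D" "\<bar>A' * x + B' * y + C'\<bar> \<le> D"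
    using shift[OF lb(1), of x y] shift[OF lb(2) \<rho>(2,3)] \<rho>0 AB by simp_all
  have at_z': "\<bar>A * x' + B * y' + C\<bar> \<le> D" "\<bar>A' * x' + B' * y' + C'\<bar> \<le> D"
    using shift[OF lb(1), of x' y'] shift[OF lb(2), of x' y'] \<rho> \<rho>0 AB by (simp_all add: abs_minus_commute)
  \<comment> \<open>The cross product of the two lines, that is, their intersection (s1/n, s2/n) in
    homogeneous coordinates. The case n = 0 of parallel lines stays included; then s2 is not
    0.\<close>
  define n s1 s2 where "n = A * B' - A' * B" and "s1 = B * C' - B' * C" and "s2 = C * A' - C' * A"
  have nonpar: "\<not> (n = 0 \<and> s2 = 0)"
    using primitive_eqI[OF lin(2) lin'(2) A0] ne by (auto simp: n_def s2_def algebra_simps)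
  have comb: "\<bar>r1 * l1 - r2 * l2\<bar> \<le> 2 * R * D"
    if "\<bar>r1\<bar> \<le> R" "\<bar>r2\<bar> \<le> R" "\<bar>l1\<bar> \<le> D" "\<bar>l2\<bar> \<le> D" for r1 r2 l1 l2 R :: real
  proof -
    have "\<bar>r1 * l1 - r2 * l2\<bar> \<le> \<bar>r1\<bar> * \<bar>l1\<bar> + \<bar>r2\<bar> * \<bar>l2\<bar>"
      using abs_triangle_ineq4[of "r1 * l1" "r2 * l2"] unfolding abs_mult by linarith
    also have "\<dots> \<le> R * D + R * D" by (intro add_mono mult_mono that abs_ge_zero) (use that in linarith)+
    finally show ?thesis by (simp add: mult_ac)
  qed
  have nx: "n * u - s1 = B' * (A * u + B * v + C) - B * (A' * u + B' * v + C')"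
    and ny: "n * v - s2 = A * (A' * u + B' * v + C') - A' * (A * u + B * v + C)" for u v :: real
    by (simp_all add: n_def s1_def s2_def algebra_simps)
  have n4: "\<bar>real_of_int n\<bar> \<le> 4 * a * b"
  proof -
    have "\<bar>real_of_int n\<bar> \<le> A * \<bar>real_of_int B'\<bar> + A' * \<bar>real_of_int B\<bar>"
      using abs_triangle_ineq4[of "real_of_int (A * B')" "real_of_int (A' * B)"] A0 by (simp add: n_def abs_mult)
    also have "\<dots> \<le> (2 * a) * b + (2 * a) * b" using lin lin' A0 pos by (intro add_mono mult_mono) auto
    finally show ?thesis by (simp add: mult_ac)
  qed
  have n_y: "\<bar>n * y - s2\<bar> \<le> 4 * a * D" "\<bar>n * y' - s2\<bar> \<le> 4 * a * D"
    unfolding ny[of y x] ny[of y' x']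
    using comb[OF AB(1,2) at_z(2,1)] comb[OF AB(1,2) at_z'(2,1)] by simp_all
  have n_x: "\<bar>n * x - s1\<bar> \<le> 2 * b * D" "\<bar>n * x - s1\<bar> \<le> 4 * a * D"
    unfolding nx[of x y] using comb[OF lin'(5) lin(5) at_z] comb[OF AB(4,3) at_z] by simp_all
  have onL: "A * s1 + B * s2 + C * n = 0" "A' * s1 + B' * s2 + C' * n = 0"
    by (simp_all add: n_def s1_def s2_def algebra_simps)
  show ?thesis
  proof (cases "444 * \<Omega> * \<theta> * t < 1")
    case True
    have 1: "\<bar>p2 * n - q * s2\<bar> < A"
      using cross_first_small[OF _ n_y(1) n4 q0(1) P(3) D_def \<Omega> pos(1-3) _ lin(3) True] near pos
      by (simp add: near_point_def)
    have 2: "\<bar>p2' * n - q' * s2\<bar> < A'"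
      using cross_first_small[OF _ n_y(2) n4 q0(2) P'(3) D_def \<Omega> pos(1-3) _ lin'(3) True] near' pos
      by (simp add: near_point_def)
    note par = points_on_line_parallel[OF lin(1) onL(1) lin(2) A0(1) 1]
      and par' = points_on_line_parallel[OF lin'(1) onL(2) lin'(2) A0(2) 2]
    have n0: "n \<noteq> 0" using par(2) q0(1) nonpar by auto
    have "n * (q * p1') = n * (q' * p1)" "n * (q * p2') = n * (q' * p2)"
      using par par' by algebra+
    then have "q * p1' = q' * p1" "q * p2' = q' * p2" using n0 by auto
    then show ?thesis using primitive_eqI[OF P(1) P'(1) q0] by auto
  next
    case False
    \<comment> \<open>Here 93312 = 8 4 54^2: the 8 is that of g^4 a bb = 8Q, and 4 54^2 arises when
      8 a b D^2 is compared with \<theta>^2/Q. The powers match because \<Omega>^4 \<theta>^2 =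
      (\<theta>\<omega>^2)^2 g^4, and 1/200000 is small enough to make 93312 444^2
      (\<theta>\<omega>^2)^2 at most 1.\<close>
    have big: "93312 * \<Omega>\<^sup>2 \<le> g ^ 4 * t\<^sup>2"
    proof -
      have "1 \<le> (444 * \<Omega> * \<theta> * t)\<^sup>2" using False by (intro one_le_power) auto
      then have "93312 * \<Omega>\<^sup>2 * 1 \<le> 93312 * \<Omega>\<^sup>2 * (444 * \<Omega> * \<theta> * t)\<^sup>2" by (intro mult_left_mono) auto
      also have "\<dots> = 93312 * 197136 * (\<theta> * \<omega>\<^sup>2)\<^sup>2 * (g ^ 4 * t\<^sup>2)"
        by (simp add: \<Omega>_def power2_eq_square power4_eq_xxxx algebra_simps)
      also have "\<dots> \<le> 1 * (g ^ 4 * t\<^sup>2)" unfolding \<theta> by (intro mult_right_mono) (auto simp: power2_eq_square)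
      finally show ?thesis by simp
    qed
    have K: "11664 * \<Omega>\<^sup>2 * (a * bb) \<le> t\<^sup>2 * Q"
    proof -
      have "93312 * \<Omega>\<^sup>2 * (a * bb) \<le> g ^ 4 * t\<^sup>2 * (a * bb)" using big pos by (intro mult_right_mono) auto
      also have "\<dots> = t\<^sup>2 * (8 * Q)" unfolding g[symmetric] by simp
      finally show ?thesis by (simp add: mult_ac)
    qed
    have \<Omega>2: "1 \<le> \<Omega>\<^sup>2" using \<Omega> by (simp add: one_le_power)
    have ab0: "0 < a * bb" using pos by simp
    have Kab: "11664 * (a * bb) \<le> t\<^sup>2 * Q"
      using K mult_right_mono[OF \<Omega>2, of "11664 * (a * bb)"] ab0 by (simp add: mult_ac)
    have abb: "4 * a * b \<le> 2 * (a * bb)" using pos mult_left_mono[OF pos(9), of "4 * a"] by simp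
    have D2: "D\<^sup>2 = 2916 * \<Omega>\<^sup>2 * \<theta>\<^sup>2 / (t\<^sup>2 * Q\<^sup>2)" by (simp add: D_def power_mult_distrib power_divide)
    have "\<theta> * 1 \<le> \<theta> * \<omega>\<^sup>2" using pos by (intro mult_left_mono one_le_power) auto
    then have \<theta>1: "\<theta> \<le> 1 / 200000" using \<theta> by simp
    have False
    proof (cases "n = 0")
      case True
      \<comment> \<open>Parallel lines give no intersection point, but then s2 is a nonzero integer
        with |s2| \<le> 4aD, so the goal is 4aD < 1.\<close>
      have "a \<le> a * bb" using pos by simp
      also have "\<dots> \<le> g ^ 4 * (a * bb)" using pos ab0 by (simp add: one_le_power)
      finally have aQ: "a \<le> 8 * Q" using g by simp
      have aa: "a\<^sup>2 \<le> a * bb * (8 * Q)"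
        unfolding power2_eq_square using \<open>a \<le> a * bb\<close> aQ pos by (intro mult_mono) auto
      have "(4 * a * D)\<^sup>2 = 16 * D\<^sup>2 * a\<^sup>2" by (simp add: power_mult_distrib)
      also have "\<dots> \<le> 16 * D\<^sup>2 * (a * bb * (8 * Q))" using aa by (intro mult_left_mono) auto
      also have "\<dots> = 32 * \<theta>\<^sup>2 * ((11664 * \<Omega>\<^sup>2 * (a * bb)) / (t\<^sup>2 * Q))"
        using pos unfolding D2 by (simp add: field_simps power2_eq_square)
      also have "\<dots> \<le> 32 * \<theta>\<^sup>2 * 1" using K tQ by (intro mult_left_mono) auto
      also have "\<dots> \<le> 32 * (1 / 200000)\<^sup>2 * 1"
        using pos \<theta>1 by (intro mult_left_mono mult_right_mono power_mono) auto
      also have "\<dots> < 1\<^sup>2" by (simp add: power2_eq_square)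
      finally have lt1: "4 * a * D < 1" by (rule power_less_imp_less_base) simp
      have "\<bar>real_of_int s2\<bar> < 1" using n_y(1) True lt1 by simp
      then have "s2 = 0" by linarith
      then show False using True nonpar by simp
    next
      case False
      define m where "m = \<bar>n\<bar>"
      have "\<bar>m * u - sgn n * s\<bar> = \<bar>n * u - s\<bar>" for u :: real and s :: int
        using False by (cases "0 < n") (auto simp: m_def)
      then have e: "\<bar>m * x - (sgn n * s1)\<bar> * \<bar>m * y - (sgn n * s2)\<bar> = \<bar>n * x - s1\<bar> * \<bar>n * y - s2\<bar>"
        by simp
      have m: "0 < m" "m < t\<^sup>2 * Q" using False n4 abb Kab ab0 by (auto simp: m_def)
      have "\<theta>\<^sup>2 / Q < \<bar>n * x - s1\<bar> * \<bar>n * y - s2\<bar>"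
        using good[OF m, of "sgn n * s1" "sgn n * s2"] e by simp
      also have "\<dots> \<le> (2 * b * D) * (4 * a * D)" using n_x(1) n_y(1) pos D0 by (intro mult_mono) auto
      also have "\<dots> = 2 * (4 * a * b) * D\<^sup>2" by (simp add: power2_eq_square)
      also have "\<dots> \<le> 2 * (2 * (a * bb)) * D\<^sup>2" using abb by (intro mult_right_mono mult_left_mono) auto
      also have "\<dots> = \<theta>\<^sup>2 / Q * ((11664 * \<Omega>\<^sup>2 * (a * bb)) / (t\<^sup>2 * Q))"
        using pos unfolding D2 by (simp add: field_simps power2_eq_square)
      also have "\<dots> \<le> \<theta>\<^sup>2 / Q * 1" using K tQ pos by (intro mult_left_mono) auto
      finally show False by simp
    qed
    then show ?thesis ..
  qed
qed

text \<open>Two pairs \<open>(A, B)\<close> in the box with the same residue of \<open>A p1 + B p2\<close> modulo \<open>q\<close> differ by the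
  required one.\<close>

lemma exists_small_line:
  fixes q p1 p2 :: int and X Y :: real
  assumes q: "0 < q" "q \<le> X * Y" and XY: "0 \<le> X" "0 \<le> Y"
  obtains A B C :: int where "A * p1 + B * p2 + C * q = 0" "A \<noteq> 0 \<or> B \<noteq> 0"
    "\<bar>A\<bar> \<le> X" "\<bar>B\<bar> \<le> Y"
proof -
  define S where "S = {0..\<lfloor>X\<rfloor>} \<times> {0..\<lfloor>Y\<rfloor>}"
  define f where "f = (\<lambda>(A, B). (A * p1 + B * p2) mod q)"
  have fin: "finite S" by (simp add: S_def)
  have fl: "0 \<le> \<lfloor>X\<rfloor>" "0 \<le> \<lfloor>Y\<rfloor>" using XY by simp_all
  \<comment> \<open>The closed box contains (floor X + 1)(floor Y + 1) > XY integer points, so area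
    exactly q is already enough for the pigeonhole principle.\<close>
  have "real_of_int q \<le> X * Y" by (rule q)
  also have "\<dots> < (real_of_int \<lfloor>X\<rfloor> + 1) * (real_of_int \<lfloor>Y\<rfloor> + 1)"
    using XY by (intro mult_strict_mono') linarith+
  also have "\<dots> = real_of_int ((\<lfloor>X\<rfloor> + 1) * (\<lfloor>Y\<rfloor> + 1))" by simp
  finally have "q < (\<lfloor>X\<rfloor> + 1) * (\<lfloor>Y\<rfloor> + 1)" by (simp only: of_int_less_iff)
  also have "\<dots> = int (card S)" using fl by (simp add: S_def)
  finally have "card {0..<q} < card S" using q(1) by simp
  moreover have "f ` S \<subseteq> {0..<q}" using q(1) by (auto simp: f_def)
  then have "card (f ` S) \<le> card {0..<q}" by (intro card_mono) auto
  ultimately have "\<not> inj_on f S" using card_image by fastforce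
  then obtain A B A' B' where AB: "(A, B) \<in> S" "(A', B') \<in> S" "(A, B) \<noteq> (A', B')" "f (A, B) = f (A', B')"
    by (auto simp: inj_on_def)
  have "q dvd (A * p1 + B * p2) - (A' * p1 + B' * p2)"
    using AB(4) by (simp add: f_def mod_eq_dvd_iff)
  then obtain k where k: "(A * p1 + B * p2) - (A' * p1 + B' * p2) = q * k" by (rule dvdE)
  show ?thesis
  proof (rule that)
    show "(A - A') * p1 + (B - B') * p2 + (- k) * q = 0" using k by (simp add: algebra_simps)
    show "A - A' \<noteq> 0 \<or> B - B' \<noteq> 0" using AB(3) by auto
    have "\<bar>A - A'\<bar> \<le> \<lfloor>X\<rfloor>" "\<bar>B - B'\<bar> \<le> \<lfloor>Y\<rfloor>" using AB(1,2) by (auto simp: S_def)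
    then show "\<bar>A - A'\<bar> \<le> X" "\<bar>B - B'\<bar> \<le> Y" by (simp_all add: le_floor_iff)
  qed
qed

lemma divide_by_content:
  fixes a b c :: int
  assumes "a \<noteq> 0 \<or> b \<noteq> 0 \<or> c \<noteq> 0"
  obtains d a' b' c' where "0 < d" "a = d * a'" "b = d * b'" "c = d * c'" "primitive a' b' c'"
proof -
  define d where "d = gcd a (gcd b c)"
  have d: "0 < d" using assms by (auto simp: d_def)
  obtain a' where a': "a = d * a'" unfolding d_def by (meson dvdE gcd_dvd1)
  obtain b' where b': "b = d * b'" unfolding d_def by (meson dvdE dvd_trans gcd_dvd1 gcd_dvd2)
  obtain c' where c': "c = d * c'" unfolding d_def by (meson dvdE dvd_trans gcd_dvd2)
  obtain u v where uv: "u * a + v * gcd b c = d" using bezout_int[of a "gcd b c"] by (auto simp: d_def)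
  obtain s t where st: "s * b + t * c = gcd b c" using bezout_int[of b c] by auto
  have "d * (u * a' + v * s * b' + v * t * c') = u * (d * a') + v * (s * (d * b') + t * (d * c'))"
    by (simp add: algebra_simps)
  also have "\<dots> = d * 1" using uv st by (simp flip: a' b' c')
  finally have "u * a' + (v * s) * b' + (v * t) * c' = 1" using d by simp
  then have "primitive a' b' c'" unfolding primitive_def by blast
  then show ?thesis using that d a' b' c' by blast
qed

lemma dyadic_scale:
  fixes n :: int
  assumes "0 < n"
  obtains i :: nat where "(2::real) ^ i \<le> n" "real_of_int n < 2 * 2 ^ i"
proof -
  have "1 \<le> nat n" using assms by simp
  from ex_power_ivl1[OF order_refl this] obtain i where i: "2 ^ i \<le> nat n" "nat n < 2 ^ (i + 1)" by blast
  have e: "real_of_int n = real (nat n)" using assms by simp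
  show ?thesis
  proof (rule that)
    show "(2::real) ^ i \<le> n" unfolding e using i(1) by (metis of_nat_le_iff of_nat_numeral of_nat_power)
    show "real_of_int n < 2 * 2 ^ i" unfolding e using i(2)
      by (metis Suc_eq_plus1 of_nat_less_iff of_nat_numeral of_nat_power power_Suc)
  qed
qed

text \<open>One or both factors vanish when x or y equals p1/q or p2/q. The sides of the pigeonhole
  box are inversely proportional to the factors, so these are enlarged to positive numbers with
  product exactly c.\<close>

lemma exists_larger_factors:
  fixes s t c :: real
  assumes "0 \<le> s" "0 \<le> t" "s * t \<le> c" "0 < c"
  obtains u v where "s \<le> u" "t \<le> v" "0 < u" "0 < v" "u * v = c"
proof (cases "s = 0")
  case False
  then show ?thesis using assms by (intro that[of s "c / s"]) (auto simp: field_simps)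
next
  case True
  show ?thesis
  proof (cases "t = 0")
    case True
    then show ?thesis using assms \<open>s = 0\<close> by (intro that[of c 1]) auto
  next
    case False
    then show ?thesis using assms \<open>s = 0\<close> by (intro that[of "c / t" t]) auto
  qed
qed

lemma rational_line_of_steep:
  fixes q p1 p2 A B C :: int and x y u v \<theta> Q :: real and l :: nat
  assumes pos: "0 < \<theta>" "0 < Q" and q: "0 < q" and l: "2 ^ l \<le> real_of_int q" "real_of_int q < 2 * 2 ^ l"
    and L: "A * p1 + B * p2 + C * q = 0" "primitive A B C" "A \<noteq> 0" "\<bar>B\<bar> \<le> \<bar>A\<bar>"
    and uv: "\<bar>q * x - p1\<bar> \<le> u" "\<bar>q * y - p2\<bar> \<le> v"
    and A: "\<bar>A\<bar> * u \<le> \<theta> * sqrt (q / Q)" and B: "\<bar>B\<bar> * v \<le> \<theta> * sqrt (q / Q)"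
    and AB: "\<bar>A\<bar> * \<bar>B\<bar> \<le> q"
  obtains i j :: nat and L where "near_point (\<theta> * sqrt (2 ^ l / Q)) (2 ^ i) (real (2 ^ j div 2)) (q, p1, p2) (x, y)"
    "rational_line (2 ^ i) (real (2 ^ j div 2)) (q, p1, p2) L" "(2::real) ^ i * 2 ^ j \<le> 8 * 2 ^ l"
proof -
  obtain i :: nat where ri: "2 ^ i \<le> \<bar>real_of_int A\<bar>" "\<bar>real_of_int A\<bar> < 2 * 2 ^ i"
    using dyadic_scale[of "\<bar>A\<bar>"] L(3) by auto
  note ql = l(2)
  have "\<exists>j. \<bar>real_of_int B\<bar> \<le> real (2 ^ j div 2) \<and> real (2 ^ j div 2) \<le> 2 * \<bar>real_of_int B\<bar> \<and>
      (2::real) ^ i * 2 ^ j \<le> 8 * 2 ^ l"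
  proof (cases "B = 0")
    case True
    \<comment> \<open>For B = 0 the bound on |AB| says nothing about A. Instead A p1 + C q = 0 and
      primitivity make A a divisor of q.\<close>
    obtain s t w where st: "s * A + t * B + w * C = 1" using L(2) by (auto simp: primitive_def)
    have "q = q * (s * A + t * B + w * C)" using st by simp
    also have "\<dots> = A * (s * q - w * p1)" using True L(1) by algebra
    finally have "A dvd q" by (rule dvdI)
    then have "\<bar>A\<bar> \<le> q" using q zdvd_imp_le[of "\<bar>A\<bar>" q] by simp
    then have "\<bar>real_of_int A\<bar> \<le> real_of_int q" by (metis of_int_abs of_int_le_iff)
    then have "(2::real) ^ i \<le> 8 * 2 ^ l" using ri(1) ql by linarith
    then show ?thesis using True by (intro exI[of _ 0]) simp
  next
    case False
    \<comment> \<open>With j = k + 2 the number b = 2^(k+1) satisfies |B| \<le> b \<le> 2|B|, and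
      2^i 2^j \<le> 4|AB| \<le> 4q < 8 2^l. This is the source of the 8 in \<open>classes\<close>
      and \<open>excess\<close>.\<close>
    obtain k :: nat where rk: "2 ^ k \<le> \<bar>real_of_int B\<bar>" "\<bar>real_of_int B\<bar> < 2 * 2 ^ k"
      using dyadic_scale[of "\<bar>B\<bar>"] False by auto
    have "(2::real) ^ i * 2 ^ (k + 2) = 4 * (2 ^ i * 2 ^ k)" by simp
    also have "\<dots> \<le> 4 * (\<bar>real_of_int A\<bar> * \<bar>real_of_int B\<bar>)"
      using ri(1) rk(1) by (intro mult_left_mono mult_mono) auto
    also have "\<bar>real_of_int A\<bar> * \<bar>real_of_int B\<bar> \<le> real_of_int q"
      using AB by (metis of_int_abs of_int_le_iff of_int_mult)
    finally have "(2::real) ^ i * 2 ^ (k + 2) \<le> 8 * 2 ^ l" using ql by simp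
    moreover have "real (2 ^ (k + 2) div 2) = 2 * 2 ^ k" by simp
    ultimately show ?thesis using rk by (intro exI[of _ "k + 2"]) simp
  qed
  then obtain j where j: "\<bar>real_of_int B\<bar> \<le> real (2 ^ j div 2)" "real (2 ^ j div 2) \<le> 2 * \<bar>real_of_int B\<bar>"
      "(2::real) ^ i * 2 ^ j \<le> 8 * 2 ^ l" by blast
  have sq: "sqrt (q / Q) \<le> 3 / 2 * sqrt (2 ^ l / Q)"
  proof -
    have "0 < (2::real) ^ l" by simp
    then have "4 * real_of_int q \<le> 9 * 2 ^ l" using ql by linarith
    then have "sqrt (q / Q) \<le> sqrt ((3 / 2)\<^sup>2 * (2 ^ l / Q))"
      using pos by (intro real_sqrt_le_mono) (simp add: power2_eq_square divide_right_mono field_simps)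
    also have "\<dots> = 3 / 2 * sqrt (2 ^ l / Q)" unfolding real_sqrt_mult by simp
    finally show ?thesis .
  qed
  then have \<theta>sq: "\<theta> * sqrt (q / Q) \<le> 3 / 2 * (\<theta> * sqrt (2 ^ l / Q))" using mult_left_mono[OF sq, of \<theta>] pos by simp
  have near: "near_point (\<theta> * sqrt (2 ^ l / Q)) (2 ^ i) (real (2 ^ j div 2)) (q, p1, p2) (x, y)"
    unfolding near_point_def prod.case
  proof
    have "2 ^ i * \<bar>q * x - p1\<bar> \<le> \<bar>real_of_int A\<bar> * u" using ri(1) uv(1) by (intro mult_mono) auto
    then show "2 ^ i * \<bar>q * x - p1\<bar> \<le> 3 / 2 * (\<theta> * sqrt (2 ^ l / Q))" using A \<theta>sq by simp
    have "real (2 ^ j div 2) * \<bar>q * y - p2\<bar> \<le> 2 * \<bar>real_of_int B\<bar> * v"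
      using j(2) uv(2) by (intro mult_mono) auto
    then show "real (2 ^ j div 2) * \<bar>q * y - p2\<bar> \<le> 3 * (\<theta> * sqrt (2 ^ l / Q))" using B \<theta>sq by simp
  qed
  obtain s t w where st: "s * A + t * B + w * C = 1" using L(2) by (auto simp: primitive_def)
  have "\<exists>L. rational_line (2 ^ i) (real (2 ^ j div 2)) (q, p1, p2) L"
  proof (cases "0 < A")
    case True
    then have "rational_line (2 ^ i) (real (2 ^ j div 2)) (q, p1, p2) (A, B, C)"
      using L ri j by (simp add: rational_line_def)
    then show ?thesis by blast
  next
    case False
    then have neg: "A < 0" using L(3) by simp
    have "(- s) * (- A) + (- t) * (- B) + (- w) * (- C) = 1" using st by simp
    then have "primitive (- A) (- B) (- C)" unfolding primitive_def by blast
    moreover have "(- A) * p1 + (- B) * p2 + (- C) * q = 0" using L(1) by simp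
    ultimately have "rational_line (2 ^ i) (real (2 ^ j div 2)) (q, p1, p2) (- A, - B, - C)"
      using L(4) ri j neg unfolding rational_line_def prod.case by simp
    then show ?thesis by blast
  qed
  then show ?thesis using that[OF near] j(3) by blast
qed

definition flip :: "bool \<Rightarrow> 'a \<times> 'a \<Rightarrow> 'a \<times> 'a"
  where "flip s z = (if s then prod.swap z else z)"

lemma exists_near_rational_line:
  fixes q p1 p2 :: int and x y \<theta> Q :: real
  assumes pos: "0 < \<theta>" "0 < Q" and q: "0 < q"
    and bad: "\<bar>q * x - p1\<bar> * \<bar>q * y - p2\<bar> \<le> \<theta>\<^sup>2 / Q"
  obtains s and i j l :: nat and L where
    "2 ^ l \<le> real_of_int q" "real_of_int q < 2 * 2 ^ l" "(2::real) ^ i * 2 ^ j \<le> 8 * 2 ^ l"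
    "near_point (\<theta> * sqrt (2 ^ l / Q)) (2 ^ i) (real (2 ^ j div 2)) (q, flip s (p1, p2)) (flip s (x, y))"
    "rational_line (2 ^ i) (real (2 ^ j div 2)) (q, flip s (p1, p2)) L"
proof -
  obtain l :: nat where l: "2 ^ l \<le> real_of_int q" "real_of_int q < 2 * 2 ^ l" using dyadic_scale[OF q] by blast
  obtain u v where uv: "\<bar>q * x - p1\<bar> \<le> u" "\<bar>q * y - p2\<bar> \<le> v" "0 < u" "0 < v" "u * v = \<theta>\<^sup>2 / Q"
    using exists_larger_factors[OF _ _ bad] pos by (metis abs_ge_zero divide_pos_pos zero_less_power)
  \<comment> \<open>Chosen so that the box with sides e/u and e/v has area e^2/(uv) = q, while |A| u
    and |B| v are both at most e.\<close>
  define e where "e = \<theta> * sqrt (q / Q)"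
  have e0: "0 < e" using pos q by (simp add: e_def)
  have "e\<^sup>2 = q * (u * v)" using pos q uv(5) by (simp add: e_def power_mult_distrib)
  then have "(e / u) * (e / v) = q" using uv(3,4) by (simp add: field_simps power2_eq_square)
  then obtain A B C :: int where L: "A * p1 + B * p2 + C * q = 0" "A \<noteq> 0 \<or> B \<noteq> 0"
     "\<bar>A\<bar> \<le> e / u" "\<bar>B\<bar> \<le> e / v"
    using exists_small_line[OF q, of "e / u" "e / v" p1 p2] e0 uv(3,4) by auto
  obtain d A' B' C' where d: "0 < d" "A = d * A'" "B = d * B'" "C = d * C'" "primitive A' B' C'"
    using divide_by_content[of A B C] L(2) by blast
  have le: "\<bar>A'\<bar> \<le> \<bar>A\<bar>" "\<bar>B'\<bar> \<le> \<bar>B\<bar>"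
    using d(1) mult_right_mono[of 1 d "\<bar>A'\<bar>"] mult_right_mono[of 1 d "\<bar>B'\<bar>"] by (auto simp: d(2,3) abs_mult)
  have le': "\<bar>real_of_int A'\<bar> \<le> e / u" "\<bar>real_of_int B'\<bar> \<le> e / v"
    using le L(3,4) by linarith+
  have "d * (A' * p1 + B' * p2 + C' * q) = 0" using L(1) d by (simp add: algebra_simps)
  then have L': "A' * p1 + B' * p2 + C' * q = 0" using d(1) by simp
  have ne: "A' \<noteq> 0 \<or> B' \<noteq> 0" using L(2) d by auto
  have Au: "\<bar>A'\<bar> * u \<le> \<theta> * sqrt (q / Q)" "\<bar>B'\<bar> * v \<le> \<theta> * sqrt (q / Q)"
    using le' uv(3,4) by (simp_all add: e_def pos_le_divide_eq)
  have "\<bar>real_of_int A'\<bar> * \<bar>real_of_int B'\<bar> \<le> (e / u) * (e / v)"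
    using le' e0 uv(3) by (intro mult_mono) auto
  then have AB: "\<bar>A'\<bar> * \<bar>B'\<bar> \<le> q" unfolding \<open>(e / u) * (e / v) = q\<close>
    by (metis of_int_abs of_int_le_iff of_int_mult)
  show ?thesis
  proof (cases "\<bar>B'\<bar> \<le> \<bar>A'\<bar>")
    case True
    then have "A' \<noteq> 0" using ne by auto
    show ?thesis
    proof (rule rational_line_of_steep[OF pos q l L' d(5) _ True uv(1,2) Au AB])
      fix i j :: nat and L
      assume "near_point (\<theta> * sqrt (2 ^ l / Q)) (2 ^ i) (real (2 ^ j div 2)) (q, p1, p2) (x, y)"
        "rational_line (2 ^ i) (real (2 ^ j div 2)) (q, p1, p2) L" "(2::real) ^ i * 2 ^ j \<le> 8 * 2 ^ l"
      then show ?thesis using that[of l i j False L] l by (simp add: flip_def)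
    qed (rule \<open>A' \<noteq> 0\<close>)
  next
    case False
    then have F: "B' \<noteq> 0" "\<bar>A'\<bar> \<le> \<bar>B'\<bar>" by auto
    have M: "B' * p2 + A' * p1 + C' * q = 0" using L' by simp
    have pr: "primitive B' A' C'" using d(5) unfolding primitive_def by (metis add.commute)
    have BA: "\<bar>B'\<bar> * \<bar>A'\<bar> \<le> q" using AB by (simp add: mult.commute)
    show ?thesis
    proof (rule rational_line_of_steep[OF pos q l M pr F uv(2,1) Au(2,1) BA])
      fix i j :: nat and L
      assume "near_point (\<theta> * sqrt (2 ^ l / Q)) (2 ^ i) (real (2 ^ j div 2)) (q, p2, p1) (y, x)"
        "rational_line (2 ^ i) (real (2 ^ j div 2)) (q, p2, p1) L" "(2::real) ^ i * 2 ^ j \<le> 8 * 2 ^ l"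
      then show ?thesis using that[of l i j True L] l by (simp add: flip_def)
    qed
  qed
qed

section \<open>Counting classes of lines\<close>

lemma card_narrow_le:
  fixes A :: "nat set"
  assumes "\<And>x y. x \<in> A \<Longrightarrow> y \<in> A \<Longrightarrow> y < x + k"
  shows "finite A \<and> card A \<le> k"
proof (cases "A = {}")
  case False
  define x where "x = (LEAST x. x \<in> A)"
  obtain a where "a \<in> A" using False by blast
  then have "x \<in> A" unfolding x_def by (rule LeastI)
  moreover have "x \<le> y" if "y \<in> A" for y unfolding x_def using that by (rule Least_le)
  ultimately have "A \<subseteq> {x..<x + k}" using assms by auto
  then show ?thesis using card_mono[of "{x..<x + k}" A] finite_subset by auto
qed simp

text \<open>The terms grow geometrically in s and the last one is at most 1, so the bound does not
  depend on X.\<close>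

lemma dyadic_sum_le:
  fixes X \<gamma> :: real
  assumes \<gamma>: "0 < \<gamma>"
  shows "finite {s::nat. 2 ^ s \<le> X}"
    and "(\<Sum>s\<in>{s::nat. 2 ^ s \<le> X}. (X / 2 ^ s) powr - \<gamma>) \<le> 1 / (1 - 2 powr - \<gamma>)"
proof -
  obtain k :: nat where "X < 2 ^ k" using real_arch_pow[of 2 X] by auto
  then have "(2::real) ^ s < 2 ^ k" if "2 ^ s \<le> X" for s :: nat using that by linarith
  then have "{s::nat. 2 ^ s \<le> X} \<subseteq> {..<k}" by auto
  then show fin: "finite {s::nat. 2 ^ s \<le> X}" using finite_subset by blast
  define z :: real where "z = 2 powr - \<gamma>"
  have z: "0 \<le> z" "z < 1" using \<gamma> powr_less_mono[of "- \<gamma>" 0 "2::real"] by (auto simp: z_def)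
  show "(\<Sum>s\<in>{s::nat. 2 ^ s \<le> X}. (X / 2 ^ s) powr - \<gamma>) \<le> 1 / (1 - 2 powr - \<gamma>)"
  proof (cases "{s::nat. 2 ^ s \<le> X} = {}")
    case True
    then show ?thesis unfolding True using z by (simp add: z_def)
  next
    case False
    define N where "N = Max {s::nat. 2 ^ s \<le> X}"
    have N: "2 ^ N \<le> X" using Max_in[OF fin False] by (simp add: N_def)
    have sub: "{s::nat. 2 ^ s \<le> X} \<subseteq> {..N}" using fin by (auto simp: N_def)
    have "(\<Sum>s\<in>{s::nat. 2 ^ s \<le> X}. (X / 2 ^ s) powr - \<gamma>) \<le> (\<Sum>s\<in>{..N}. (X / 2 ^ s) powr - \<gamma>)"
      using sub by (intro sum_mono2) auto
    also have "\<dots> \<le> (\<Sum>s\<in>{..N}. z ^ (N - s))"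
    proof (rule sum_mono)
      fix s assume "s \<in> {..N}"
      then have e: "(2::real) ^ N = 2 ^ (N - s) * 2 ^ s" by (simp flip: power_add)
      have "2 ^ (N - s) \<le> X / 2 ^ s" using N e by (simp add: pos_le_divide_eq)
      then have "(X / 2 ^ s) powr - \<gamma> \<le> (2 ^ (N - s)) powr - \<gamma>"
        using \<gamma> by (intro powr_mono2') auto
      also have "\<dots> = z ^ (N - s)" by (simp add: z_def powr_realpow[symmetric] powr_powr mult.commute)
      finally show "(X / 2 ^ s) powr - \<gamma> \<le> z ^ (N - s)" .
    qed
    also have "\<dots> = (\<Sum>k<Suc N. z ^ k)"
      using sum.nat_diff_reindex[of "\<lambda>k. z ^ k" "Suc N"] by (simp add: lessThan_Suc_atMost)
    also have "\<dots> \<le> suminf (\<lambda>k. z ^ k)"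
      using z by (intro sum_le_suminf summable_geometric) auto
    also have "\<dots> = 1 / (1 - z)" using z by (intro suminf_geometric) auto
    finally show ?thesis by (simp add: z_def)
  qed
qed

text \<open>A class \<open>(i, j, l)\<close> consists of the lines with \<open>A \<approx> 2\<^sup>i\<close>, \<open>B \<approx> 2\<^sup>j\<close> through points
  of denominator \<open>q \<approx> 2\<^sup>l\<close>; \<open>excess\<close> is the quantity \<open>8Q/(AB) \<ge> Q/q\<close>.\<close>

definition excess :: "real \<Rightarrow> nat \<times> nat \<times> nat \<Rightarrow> real"
  where "excess Q = (\<lambda>(i, j, l). 8 * Q / (2 ^ i * 2 ^ j))"

text \<open>Multiplied by 6\<theta>\<omega>, this is the radius up to which
  \<open>unique_line\<close> applies to the class: \<omega> times the strip width times the gain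
  \<open>excess\<close>^(1/4). Leaving out \<theta> and \<omega> keeps the counting independent of
  their choice.\<close>

definition class_scale :: "real \<Rightarrow> nat \<times> nat \<times> nat \<Rightarrow> real"
  where "class_scale Q \<kappa> = (case \<kappa> of (i, j, l) \<Rightarrow> excess Q \<kappa> powr (1 / 4) / (2 ^ i * sqrt (2 ^ l / Q) * Q))"

definition classes :: "real \<Rightarrow> (nat \<times> nat \<times> nat) set"
  where "classes Q = {(i, j, l). 2 ^ l \<le> Q \<and> (2::real) ^ i * 2 ^ j \<le> 8 * 2 ^ l}"

lemma excess_ge: "(i, j, l) \<in> classes Q \<Longrightarrow> 0 < Q \<Longrightarrow> Q / 2 ^ l \<le> excess Q (i, j, l)"
  by (auto simp: classes_def excess_def field_simps)

lemma excess_ge_1: "\<kappa> \<in> classes Q \<Longrightarrow> 0 < Q \<Longrightarrow> 1 \<le> excess Q \<kappa>"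
  using excess_ge by (fastforce simp: classes_def pos_le_divide_eq elim!: order_trans[rotated])

text \<open>For fixed s = i + j and l the scale is H(s, l)/2^i, so the window between R and
  R/\<beta> leaves at most K values of i. Half of the exponent 2\<gamma> then pays for the sum over
  s, as \<open>excess\<close> is 8Q/2^s, and the other half for the sum over l, as
  \<open>excess\<close> is at least Q/2^l.\<close>

lemma single_scale_sum_le:
  fixes \<gamma> \<beta> R Q :: real and K :: nat
  assumes \<gamma>: "0 < \<gamma>" and \<beta>: "0 < \<beta>" "1 / \<beta> < 2 ^ K" and R: "0 < R" and Q: "0 < Q"
  defines "T \<equiv> {\<kappa> \<in> classes Q. \<beta> * class_scale Q \<kappa> \<le> R \<and> R \<le> class_scale Q \<kappa>}"
  shows "finite T" "(\<Sum>\<kappa>\<in>T. excess Q \<kappa> powr - (2 * \<gamma>)) \<le> real K * (1 / (1 - 2 powr - \<gamma>))\<^sup>2"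
proof -
  let ?S = "{s::nat. 2 ^ s \<le> 8 * Q}" and ?L = "{l::nat. 2 ^ l \<le> Q}"
  define H where "H s l = (8 * Q / 2 ^ s) powr (1 / 4) / (sqrt (2 ^ l / Q) * Q)" for s l :: nat
  define I where "I s l = {i::nat. \<beta> * H s l \<le> R * 2 ^ i \<and> R * 2 ^ i \<le> H s l}" for s l
  define f where "f = (\<lambda>(i::nat, j, l::nat). (i + j, l, i))"
  let ?P = "SIGMA s:?S. SIGMA l:?L. I s l"
  let ?h = "\<lambda>s::nat. (8 * Q / 2 ^ s) powr - \<gamma>" and ?k = "\<lambda>l::nat. (Q / 2 ^ l) powr - \<gamma>"
  have I: "finite (I s l) \<and> card (I s l) \<le> K" for s l
  proof (rule card_narrow_le)
    fix x y assume xy: "x \<in> I s l" "y \<in> I s l"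
    have "\<beta> * (R * 2 ^ y) \<le> \<beta> * H s l" using xy(2) \<beta> by (intro mult_left_mono) (auto simp: I_def)
    also have "\<dots> \<le> R * 2 ^ x" using xy(1) by (simp add: I_def)
    finally have "2 ^ y \<le> 2 ^ x * (1 / \<beta>)" using R \<beta> by (simp add: field_simps)
    also have "\<dots> < 2 ^ x * 2 ^ K" using \<beta> by (intro mult_strict_left_mono) auto
    finally have "(2::real) ^ y < 2 ^ (x + K)" by (simp add: power_add)
    then show "y < x + K" by (simp add: power_strict_increasing_iff)
  qed
  have scale: "class_scale Q (i, j, l) = H (i + j) l / 2 ^ i" for i j l
    by (simp add: class_scale_def excess_def H_def power_add mult_ac)
  have inj: "inj_on f T" by (auto simp: inj_on_def f_def)
  have sub: "f ` T \<subseteq> ?P"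
  proof
    fix p assume "p \<in> f ` T"
    then obtain i j l where ijl: "(i, j, l) \<in> T" "p = (i + j, l, i)" by (auto simp: f_def)
    have 1: "2 ^ l \<le> Q" "(2::real) ^ (i + j) \<le> 8 * 2 ^ l" using ijl(1) by (auto simp: T_def classes_def power_add)
    have "\<beta> * (H (i + j) l / 2 ^ i) \<le> R" "R \<le> H (i + j) l / 2 ^ i"
      using ijl(1) by (auto simp: T_def scale)
    then have "i \<in> I (i + j) l" by (simp add: I_def field_simps)
    then show "p \<in> ?P" using 1 ijl(2) by simp
  qed
  have finP: "finite ?P" using I dyadic_sum_le(1)[OF \<gamma>] by (intro finite_SigmaI) auto
  have "finite (f ` T)" using finite_subset[OF sub finP] .
  then show "finite T" using inj by (simp add: finite_image_iff)
  have "(\<Sum>\<kappa>\<in>T. excess Q \<kappa> powr - (2 * \<gamma>)) \<le> (\<Sum>\<kappa>\<in>T. (case f \<kappa> of (s, l, i) \<Rightarrow> ?h s * ?k l))"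
  proof (rule sum_mono)
    fix \<kappa> assume "\<kappa> \<in> T"
    moreover obtain i j l where \<kappa>: "\<kappa> = (i, j, l)" by (cases \<kappa>)
    ultimately have c: "(i, j, l) \<in> classes Q" by (simp add: T_def)
    have e: "excess Q \<kappa> = 8 * Q / 2 ^ (i + j)" by (simp add: excess_def \<kappa> power_add)
    have "excess Q \<kappa> powr - (2 * \<gamma>) = excess Q \<kappa> powr - \<gamma> * excess Q \<kappa> powr - \<gamma>"
      by (simp flip: powr_add)
    also have "\<dots> \<le> ?h (i + j) * ?k l"
    proof (intro mult_mono)
      show "excess Q \<kappa> powr - \<gamma> \<le> ?h (i + j)" by (simp add: e)
      show "excess Q \<kappa> powr - \<gamma> \<le> ?k l" using excess_ge[OF c Q] Q \<gamma> by (simp add: \<kappa> powr_mono2')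
    qed auto
    finally show "excess Q \<kappa> powr - (2 * \<gamma>) \<le> (case f \<kappa> of (s, l, i) \<Rightarrow> ?h s * ?k l)"
      by (simp add: f_def \<kappa>)
  qed
  also have "\<dots> = (\<Sum>(s, l, i)\<in>f ` T. ?h s * ?k l)" using inj by (simp add: sum.reindex)
  also have "\<dots> \<le> (\<Sum>(s, l, i)\<in>?P. ?h s * ?k l)"
    using sub finP by (intro sum_mono2) auto
  also have "\<dots> = (\<Sum>s\<in>?S. \<Sum>l\<in>?L. \<Sum>i\<in>I s l. ?h s * ?k l)"
  proof -
    have "(\<Sum>s\<in>?S. \<Sum>l\<in>?L. \<Sum>i\<in>I s l. ?h s * ?k l) = (\<Sum>s\<in>?S. \<Sum>(l, i)\<in>Sigma ?L (I s). ?h s * ?k l)"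
      using I dyadic_sum_le(1)[OF \<gamma>] by (intro sum.cong refl sum.Sigma) auto
    also have "\<dots> = (\<Sum>(s, l, i)\<in>?P. ?h s * ?k l)"
      using I dyadic_sum_le(1)[OF \<gamma>] by (intro sum.Sigma) auto
    finally show ?thesis by simp
  qed
  also have "\<dots> \<le> (\<Sum>s\<in>?S. \<Sum>l\<in>?L. real K * (?h s * ?k l))"
    using I by (intro sum_mono) (auto intro!: mult_right_mono)
  also have "\<dots> = real K * ((\<Sum>s\<in>?S. ?h s) * (\<Sum>l\<in>?L. ?k l))"
    unfolding sum_product by (simp only: sum_distrib_left)
  also have "\<dots> \<le> real K * ((1 / (1 - 2 powr - \<gamma>)) * (1 / (1 - 2 powr - \<gamma>)))"
    using dyadic_sum_le(2)[OF \<gamma>] powr_less_mono[of "- \<gamma>" 0 "2::real"] \<gamma>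
    by (intro mult_left_mono mult_mono) (auto intro!: sum_nonneg)
  finally show "(\<Sum>\<kappa>\<in>T. excess Q \<kappa> powr - (2 * \<gamma>)) \<le> real K * (1 / (1 - 2 powr - \<gamma>))\<^sup>2"
    by (simp add: power2_eq_square)
qed

text \<open>The lower bound uses 2^i \<le> 8Q and \<open>excess\<close> at least 1; the upper bound
  uses 2^l \<ge> 1 and 8^(1/4) \<le> 2. The exponents 2 and 1/4 have ratio 8, which determines how
  much growth of Q separates the scales of different m.\<close>

lemma class_scale_bounds:
  assumes \<kappa>: "\<kappa> \<in> classes Q" and Q: "1 \<le> Q"
  shows "1 / (8 * Q\<^sup>2) \<le> class_scale Q \<kappa>" "class_scale Q \<kappa> \<le> 2 * Q powr - (1 / 4)"
proof -
  obtain i j l where ijl: "\<kappa> = (i, j, l)" by (cases \<kappa>)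
  have c: "2 ^ l \<le> Q" "(2::real) ^ i * 2 ^ j \<le> 8 * 2 ^ l" using \<kappa> by (auto simp: ijl classes_def)
  have e: "excess Q \<kappa> = 8 * Q / (2 ^ i * 2 ^ j)" by (simp add: excess_def ijl)
  have t: "sqrt (2 ^ l / Q) \<le> 1" "1 / sqrt Q \<le> sqrt (2 ^ l / Q)"
    using c(1) Q by (auto simp: real_sqrt_divide intro!: divide_right_mono)
  have t0: "0 < sqrt (2 ^ l / Q)" using Q by simp
  have "(2::real) ^ i * 1 \<le> 2 ^ i * 2 ^ j" by (intro mult_left_mono) auto
  then have i: "(2::real) ^ i \<le> 8 * Q" using c by linarith
  have D: "2 ^ i * sqrt (2 ^ l / Q) * Q \<le> 8 * Q * 1 * Q"
    using i t(1) t0 Q by (intro mult_mono) auto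
  have D0: "0 < 2 ^ i * sqrt (2 ^ l / Q) * Q" using Q t0 by simp
  have "1 / (8 * Q\<^sup>2) \<le> 1 / (2 ^ i * sqrt (2 ^ l / Q) * Q)"
    using D D0 by (intro divide_left_mono) (auto simp: power2_eq_square intro!: mult_pos_pos)
  also have "\<dots> \<le> excess Q \<kappa> powr (1 / 4) / (2 ^ i * sqrt (2 ^ l / Q) * Q)"
    using D0 excess_ge_1[OF \<kappa>] Q by (intro divide_right_mono ge_one_powr_ge_zero) auto
  finally show "1 / (8 * Q\<^sup>2) \<le> class_scale Q \<kappa>" by (simp add: class_scale_def ijl)
  have "1 * 1 \<le> (2::real) ^ i * 2 ^ j" by (intro mult_mono) auto
  then have "excess Q \<kappa> \<le> 8 * Q / 1" unfolding e using Q by (intro divide_left_mono) auto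
  then have "excess Q \<kappa> powr (1 / 4) \<le> (8 * Q) powr (1 / 4)"
    using excess_ge_1[OF \<kappa>] Q by (intro powr_mono2) auto
  also have "\<dots> \<le> (16 * Q) powr (1 / 4)" using Q by (intro powr_mono2) auto
  also have "\<dots> = 2 * Q powr (1 / 4)"
  proof -
    have "(16::real) powr (1 / 4) = (2 powr 4) powr (1 / 4)" by simp
    also have "\<dots> = 2" by (simp only: powr_powr) simp
    finally show ?thesis using Q by (simp add: powr_mult)
  qed
  finally have num: "excess Q \<kappa> powr (1 / 4) \<le> 2 * Q powr (1 / 4)" .
  have "sqrt Q = 1 * (1 / sqrt Q) * Q" using Q by (simp add: real_div_sqrt)
  also have "\<dots> \<le> 2 ^ i * sqrt (2 ^ l / Q) * Q" using t Q by (intro mult_right_mono mult_mono) auto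
  finally have "class_scale Q \<kappa> \<le> 2 * Q powr (1 / 4) / sqrt Q"
    using num Q D0 by (auto simp: class_scale_def ijl intro!: frac_le)
  also have "\<dots> = 2 * Q powr - (1 / 4)"
    using Q powr_diff[of Q "1 / 4" "1 / 2"] by (simp add: powr_half_sqrt[symmetric])
  finally show "class_scale Q \<kappa> \<le> 2 * Q powr - (1 / 4)" .
qed

text \<open>Lowering \<tau> to \<tau>' absorbs the constant c once Q m is large, and iteration
  raises the exponent \<tau>'^k above 9. The 9 leaves one power of Q m to spare over the ratio 8 of
  \<open>class_scale_bounds\<close>, enough to beat a constant.\<close>

lemma superexponential_growth:
  fixes Q :: "nat \<Rightarrow> real"
  assumes Q: "filterlim Q at_top sequentially" "\<And>m. 0 < Q m"
    and \<tau>: "1 < \<tau>" "0 < c" "\<And>m. c * Q m powr \<tau> \<le> Q (Suc m)"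
  obtains m0 k where "\<And>m. m0 \<le> m \<Longrightarrow> X \<le> Q m" "\<And>m. m0 \<le> m \<Longrightarrow> Q m ^ 9 < Q (m + k)"
proof -
  define \<tau>' where "\<tau>' = (1 + \<tau>) / 2"
  have \<tau>': "1 < \<tau>'" "\<tau>' < \<tau>" using \<tau>(1) by (auto simp: \<tau>'_def)
  define Y where "Y = max (max X 2) ((1 / c) powr (1 / (\<tau> - \<tau>')))"
  obtain m0 where m0: "\<And>m. m0 \<le> m \<Longrightarrow> Y \<le> Q m"
    using Q(1) unfolding filterlim_at_top eventually_sequentially by blast
  obtain k where k: "9 < \<tau>' ^ k" using real_arch_pow[OF \<tau>'(1)] by blast
  have Q2: "2 \<le> Q m" "X \<le> Q m" "(1 / c) powr (1 / (\<tau> - \<tau>')) \<le> Q m" if "m0 \<le> m" for m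
    using m0[OF that] by (auto simp: Y_def)
  have step: "Q m powr \<tau>' \<le> Q (Suc m)" if "m0 \<le> m" for m
  proof -
    have "1 / c = ((1 / c) powr (1 / (\<tau> - \<tau>'))) powr (\<tau> - \<tau>')" using \<tau> \<tau>' by (simp add: powr_powr)
    also have "\<dots> \<le> Q m powr (\<tau> - \<tau>')" using Q2(3)[OF that] \<tau>' by (intro powr_mono2) auto
    finally have "1 \<le> c * Q m powr (\<tau> - \<tau>')" using \<tau>(2) by (simp add: field_simps)
    then have "1 * Q m powr \<tau>' \<le> c * Q m powr (\<tau> - \<tau>') * Q m powr \<tau>'" by (intro mult_right_mono) auto
    also have "\<dots> = c * Q m powr \<tau>" by (simp flip: powr_add add: mult.assoc)
    finally show ?thesis using \<tau>(3)[of m] by simp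
  qed
  have iter: "Q m powr (\<tau>' ^ n) \<le> Q (m + n)" if "m0 \<le> m" for m n
  proof (induction n)
    case (Suc n)
    have "Q m powr (\<tau>' ^ Suc n) = (Q m powr (\<tau>' ^ n)) powr \<tau>'" by (simp add: powr_powr mult.commute)
    also have "\<dots> \<le> Q (m + n) powr \<tau>'" using Suc \<tau>' by (intro powr_mono2) auto
    also have "\<dots> \<le> Q (m + Suc n)" using step[of "m + n"] that by simp
    finally show ?case .
  qed (use Q(2)[of m] in simp)
  show ?thesis
  proof (rule that)
    fix m assume m: "m0 \<le> m"
    show "X \<le> Q m" using Q2[OF m] by simp
    have "Q m ^ 9 = Q m powr 9" using Q2[OF m] by (simp add: powr_numeral)
    also have "\<dots> < Q m powr (\<tau>' ^ k)" using Q2(1)[OF m] k by (intro powr_less_mono) auto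
    also have "\<dots> \<le> Q (m + k)" by (rule iter[OF m])
    finally show "Q m ^ 9 < Q (m + k)" .
  qed
qed

definition active_classes :: "(nat \<Rightarrow> real) \<Rightarrow> nat \<Rightarrow> real \<Rightarrow> real \<Rightarrow> (nat \<times> nat \<times> nat \<times> nat) set"
  where "active_classes Q m0 \<beta> R = (SIGMA m:{m0..}. {\<kappa> \<in> classes (Q m). \<beta> * class_scale (Q m) \<kappa> \<le> R \<and> R \<le> class_scale (Q m) \<kappa>})"

text \<open>If m and m' both have a class at scale R, then \<beta>/(8 Q_m^2) \<le> R \<le> 2
  Q_m'^(-1/4), hence Q_m' \<le> (65536/\<beta>^4) Q_m^8 < Q_(m+k). So at most k indices occur at
  each scale, each with a bounded sum.\<close>

lemma class_sum_bound:
  fixes Q :: "nat \<Rightarrow> real" and \<beta> \<gamma> :: real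
  assumes Q: "filterlim Q at_top sequentially" "\<And>m. 0 < Q m" "strict_mono Q"
    and \<tau>: "1 < \<tau>" "0 < c" "\<And>m. c * Q m powr \<tau> \<le> Q (Suc m)"
    and \<beta>: "0 < \<beta>" and \<gamma>: "0 < \<gamma>"
  obtains m0 S where "0 < S" "\<And>m. m0 \<le> m \<Longrightarrow> 1 \<le> Q m"
    "\<And>R. 0 < R \<Longrightarrow> finite (active_classes Q m0 \<beta> R)"
    "\<And>R. 0 < R \<Longrightarrow> (\<Sum>(m, \<kappa>)\<in>active_classes Q m0 \<beta> R.
        excess (Q m) \<kappa> powr - \<gamma>) \<le> S"
proof -
  obtain m0 k where X: "\<And>m. m0 \<le> m \<Longrightarrow> max 1 (65536 / \<beta> ^ 4) \<le> Q m"
    and grow: "\<And>m. m0 \<le> m \<Longrightarrow> Q m ^ 9 < Q (m + k)"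
    using superexponential_growth[OF Q(1,2) \<tau>, of "max 1 (65536 / \<beta> ^ 4)"] by blast
  have Q1: "1 \<le> Q m" if "m0 \<le> m" for m using X[OF that] by simp
  obtain K :: nat where K: "1 / \<beta> < 2 ^ K" using real_arch_pow[of 2 "1 / \<beta>"] by auto
  define G where "G = real K * (1 / (1 - 2 powr - (\<gamma> / 2)))\<^sup>2"
  have G0: "0 \<le> G" by (simp add: G_def)
  define T where "T R m = {\<kappa> \<in> classes (Q m). \<beta> * class_scale (Q m) \<kappa> \<le> R \<and> R \<le> class_scale (Q m) \<kappa>}" for R m
  have T: "finite (T R m)" "(\<Sum>\<kappa>\<in>T R m. excess (Q m) \<kappa> powr - \<gamma>) \<le> G" if "0 < R" for R m
    unfolding T_def G_def using single_scale_sum_le[of "\<gamma> / 2", OF _ \<beta> K that Q(2)] \<gamma> by simp_all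
  define Ms where "Ms R = {m. m0 \<le> m \<and> T R m \<noteq> {}}" for R
  have Ms: "finite (Ms R) \<and> card (Ms R) \<le> k" if R: "0 < R" for R
  proof (rule card_narrow_le)
    fix m m' assume m: "m \<in> Ms R" "m' \<in> Ms R"
    obtain \<kappa> \<kappa>' where \<kappa>: "\<kappa> \<in> T R m" "\<kappa>' \<in> T R m'" using m by (auto simp: Ms_def)
    have mm: "m0 \<le> m" "m0 \<le> m'" using m by (auto simp: Ms_def)
    have "R \<le> 2 * Q m' powr - (1 / 4)"
      using class_scale_bounds(2)[OF _ Q1[OF mm(2)], of \<kappa>'] \<kappa>(2) by (simp add: T_def)
    moreover have "\<beta> * (1 / (8 * (Q m)\<^sup>2)) \<le> \<beta> * class_scale (Q m) \<kappa>"
      using class_scale_bounds(1)[OF _ Q1[OF mm(1)], of \<kappa>] \<kappa>(1) \<beta> by (intro mult_left_mono) (auto simp: T_def)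
    ultimately have "\<beta> * (1 / (8 * (Q m)\<^sup>2)) \<le> 2 * Q m' powr - (1 / 4)" using \<kappa>(1) by (simp add: T_def)
    then have "Q m' powr (1 / 4) \<le> 16 * (Q m)\<^sup>2 / \<beta>"
      using Q(2)[of m] Q(2)[of m'] \<beta> by (simp add: powr_minus field_simps)
    then have "(Q m' powr (1 / 4)) ^ 4 \<le> (16 * (Q m)\<^sup>2 / \<beta>) ^ 4" by (intro power_mono) auto
    then have "Q m' \<le> 65536 / \<beta> ^ 4 * Q m ^ 8"
      using Q(2)[of m'] by (simp add: powr_power power_divide power_mult_distrib flip: power_mult)
    also have "\<dots> \<le> Q m * Q m ^ 8" using X[OF mm(1)] Q(2)[of m] by (intro mult_right_mono) auto
    also have "\<dots> = Q m ^ 9" by (simp add: power_numeral_reduce)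
    also have "\<dots> < Q (m + k)" by (rule grow[OF mm(1)])
    finally show "m' < m + k" using Q(3) by (simp add: strict_mono_less)
  qed
  have eq: "active_classes Q m0 \<beta> R = (SIGMA m:Ms R. T R m)" for R
    by (auto simp: Ms_def T_def active_classes_def)
  show ?thesis
  proof (rule that)
    show "0 < k * G + 1" using G0 by (simp add: add_nonneg_pos)
    fix R :: real assume R: "0 < R"
    show "finite (active_classes Q m0 \<beta> R)"
      unfolding eq using Ms[OF R] T(1)[OF R] by (intro finite_SigmaI) auto
    have "(\<Sum>(m, \<kappa>)\<in>active_classes Q m0 \<beta> R. excess (Q m) \<kappa> powr - \<gamma>)
        = (\<Sum>m\<in>Ms R. \<Sum>\<kappa>\<in>T R m. excess (Q m) \<kappa> powr - \<gamma>)"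
      unfolding eq using Ms[OF R] T(1)[OF R] by (simp add: sum.Sigma)
    also have "\<dots> \<le> (\<Sum>m\<in>Ms R. G)" using T(2)[OF R] by (intro sum_mono)
    also have "\<dots> \<le> k * G" using Ms[OF R] G0 by (simp add: mult_right_mono)
    finally show "(\<Sum>(m, \<kappa>)\<in>active_classes Q m0 \<beta> R.
        excess (Q m) \<kappa> powr - \<gamma>) \<le> k * G + 1" by simp
  qed (rule Q1)
qed

section \<open>Strips around rational lines\<close>

lemma infdist_hyperplane_le:
  fixes a z :: "'a::euclidean_space"
  assumes a: "a \<noteq> 0"
  shows "infdist z {z. a \<bullet> z = b} \<le> \<bar>a \<bullet> z - b\<bar> / norm a"
proof -
  define w where "w = z - ((a \<bullet> z - b) / (a \<bullet> a)) *\<^sub>R a"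
  have "a \<bullet> w = b" using a by (simp add: w_def inner_diff_right)
  then have "infdist z {z. a \<bullet> z = b} \<le> dist z w" by (intro infdist_le) simp
  also have "\<dots> = \<bar>a \<bullet> z - b\<bar> / (a \<bullet> a) * norm a" by (simp add: w_def dist_norm)
  also have "\<dots> = \<bar>a \<bullet> z - b\<bar> / norm a"
    using a by (simp add: power2_norm_eq_inner[symmetric] power2_eq_square)
  finally show ?thesis .
qed

definition line_set :: "bool \<Rightarrow> int \<times> int \<times> int \<Rightarrow> (real \<times> real) set"
  where "line_set s = (\<lambda>(A, B, C). {z. flip s (real_of_int A, real_of_int B) \<bullet> z = - real_of_int C})"

lemma flip_inner: "flip s (u, v) \<bullet> z = u * fst (flip s z) + v * snd (flip s z)" for u v :: real
  by (cases z) (simp add: flip_def)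

lemma affine_hyperplane_line_set: "A \<noteq> 0 \<Longrightarrow> affine_hyperplane (line_set s (A, B, C))"
  unfolding affine_hyperplane_def line_set_def prod.case
  by (intro exI[of _ "flip s (real_of_int A, real_of_int B)"] exI[of _ "- real_of_int C"])
    (auto simp: flip_def zero_prod_def)

lemma line_set_nbhd:
  assumes "0 < a" "a \<le> real_of_int A" "\<bar>A * fst (flip s z) + B * snd (flip s z) + C\<bar> \<le> \<delta>"
  shows "z \<in> hyperplane_nbhd (line_set s (A, B, C)) (\<delta> / a)"
proof -
  let ?v = "flip s (real_of_int A, real_of_int B)"
  have v0: "?v \<noteq> 0" using assms by (auto simp: flip_def zero_prod_def)
  have "norm ?v = sqrt ((real_of_int A)\<^sup>2 + (real_of_int B)\<^sup>2)" by (simp add: flip_def norm_Pair add.commute)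
  then have na: "a \<le> norm ?v" using assms(2) real_sqrt_sum_squares_ge1[of "real_of_int A" "real_of_int B"] by linarith
  have "infdist z (line_set s (A, B, C)) \<le> \<bar>?v \<bullet> z - - real_of_int C\<bar> / norm ?v"
    unfolding line_set_def prod.case by (rule infdist_hyperplane_le[OF v0])
  also have "\<dots> \<le> \<delta> / a"
    using assms na by (intro frac_le) (auto simp: flip_inner)
  finally show ?thesis by (simp add: hyperplane_nbhd_def)
qed

text \<open>Several lines of one class may pass through the same point. Choosing one as a function
  of the point alone is what turns the conclusion of \<open>unique_line\<close>, equality of the
  points, into equality of the lines.\<close>

definition pick_line :: "nat \<Rightarrow> nat \<Rightarrow> int \<times> int \<times> int \<Rightarrow> int \<times> int \<times> int"
  where "pick_line i j P = (SOME L. rational_line (2 ^ i) (real (2 ^ j div 2)) P L)"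

text \<open>The class \<open>j = 0\<close> consists of the lines with \<open>B = 0\<close>, since \<open>2\<^sup>0 div 2 = 0\<close>. The flag \<open>s\<close>
  exchanges the coordinates, so that only lines with \<open>|B| \<le> |A|\<close> occur.\<close>

definition candidates :: "real \<Rightarrow> real \<Rightarrow> bool \<Rightarrow> nat \<times> nat \<times> nat \<Rightarrow> (real \<times> real) game_ball \<Rightarrow> (int \<times> int \<times> int) set"
  where "candidates \<theta> Q s = (\<lambda>(i, j, l) B. {pick_line i j (q, p1, p2) | q p1 p2.
     primitive q p1 p2 \<and> 2 ^ l \<le> real_of_int q \<and> real_of_int q < 2 * 2 ^ l \<and>
     (\<exists>L. rational_line (2 ^ i) (real (2 ^ j div 2)) (q, p1, p2) L) \<and>
     (\<exists>z\<in>ball_set B. near_point (\<theta> * sqrt (2 ^ l / Q)) (2 ^ i) (real (2 ^ j div 2)) (q, p1, p2) (flip s z))})"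

definition strip_width :: "real \<Rightarrow> real \<Rightarrow> nat \<times> nat \<times> nat \<Rightarrow> real"
  where "strip_width \<theta> Q = (\<lambda>(i, j, l). 6 * \<theta> / (sqrt (2 ^ l / Q) * Q) / 2 ^ i)"

definition strip :: "real \<Rightarrow> real \<Rightarrow> bool \<Rightarrow> nat \<times> nat \<times> nat \<Rightarrow> (real \<times> real) game_ball \<Rightarrow> (real \<times> real) game_nbhd"
  where "strip \<theta> Q s \<kappa> B = (line_set s (SOME L. L \<in> candidates \<theta> Q s \<kappa> B), strip_width \<theta> Q \<kappa>)"

lemma candidates_line:
  assumes "L \<in> candidates \<theta> Q s (i, j, l) B"
  obtains q p1 p2 z where "L = pick_line i j (q, p1, p2)" "rational_line (2 ^ i) (real (2 ^ j div 2)) (q, p1, p2) L"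
    "primitive q p1 p2" "2 ^ l \<le> real_of_int q" "real_of_int q < 2 * 2 ^ l" "z \<in> ball_set B"
    "near_point (\<theta> * sqrt (2 ^ l / Q)) (2 ^ i) (real (2 ^ j div 2)) (q, p1, p2) (flip s z)"
proof -
  obtain q p1 p2 z L' where *: "L = pick_line i j (q, p1, p2)" "rational_line (2 ^ i) (real (2 ^ j div 2)) (q, p1, p2) L'"
    "primitive q p1 p2" "2 ^ l \<le> real_of_int q" "real_of_int q < 2 * 2 ^ l" "z \<in> ball_set B"
    "near_point (\<theta> * sqrt (2 ^ l / Q)) (2 ^ i) (real (2 ^ j div 2)) (q, p1, p2) (flip s z)"
    using assms unfolding candidates_def prod.case by blast
  have "rational_line (2 ^ i) (real (2 ^ j div 2)) (q, p1, p2) L"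
    unfolding *(1) pick_line_def using *(2) by (rule someI)
  then show ?thesis using that * by blast
qed

lemma class_scale_width:
  "class_scale Q \<kappa> * (6 * \<theta>) = excess Q \<kappa> powr (1 / 4) * strip_width \<theta> Q \<kappa>"
  by (cases \<kappa>) (simp add: class_scale_def strip_width_def mult_ac)

text \<open>Strong induction on q: the claim for smaller denominators is the hypothesis
  \<open>good\<close> of \<open>unique_line\<close>. That lemma compares the line through a bad
  point with the line chosen for the strip; they agree, so (x, y) would lie in a strip that it
  avoids. \<open>W \<kappa> n\<close> expresses that the class \<kappa> is treated at the ball
  \<open>B n\<close>.\<close>

lemma no_bad_denominator:
  fixes B :: "nat \<Rightarrow> (real \<times> real) game_ball" and \<theta> \<omega> Q x y :: real
    and q p1 p2 :: int
  assumes pos: "0 < \<theta>" "1 \<le> \<omega>" "0 < Q" and \<theta>: "\<theta> * \<omega>\<^sup>2 = 1 / 200000"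
    and z: "\<And>n. (x, y) \<in> ball_set (B n)"
    and scale: "\<And>\<kappa>. \<kappa> \<in> classes Q \<Longrightarrow> \<exists>n. W \<kappa> n \<and> snd (B n) \<le> 6 * \<theta> * \<omega> * class_scale Q \<kappa>"
    and avoid: "\<And>s \<kappa> n. \<kappa> \<in> classes Q \<Longrightarrow> W \<kappa> n \<Longrightarrow> candidates \<theta> Q s \<kappa> (B n) \<noteq> {} \<Longrightarrow>
       (x, y) \<notin> hyperplane_nbhd (fst (strip \<theta> Q s \<kappa> (B n))) (snd (strip \<theta> Q s \<kappa> (B n)))"
  shows "0 < q \<Longrightarrow> real_of_int q \<le> Q \<Longrightarrow> \<theta>\<^sup>2 / Q < \<bar>q * x - p1\<bar> * \<bar>q * y - p2\<bar>"
proof (induction "nat q" arbitrary: q p1 p2 rule: less_induct)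
  case less
  have IH: "\<theta>\<^sup>2 / Q < \<bar>n * x - m1\<bar> * \<bar>n * y - m2\<bar>" if "0 < n" "n < q" for n m1 m2 :: int
    using less(1)[of n m1 m2] that less(2,3) by (auto simp: nat_less_iff less_imp_le)
  show ?case
  proof (rule ccontr)
    assume "\<not> ?case"
    then have bad: "\<bar>q * x - p1\<bar> * \<bar>q * y - p2\<bar> \<le> \<theta>\<^sup>2 / Q" by simp
    \<comment> \<open>Cancelling the content shrinks the denominator and both factors, so by the
      induction hypothesis a bad triple is already primitive.\<close>
    obtain d q' p1' p2' where d: "0 < d" "q = d * q'" "p1 = d * p1'" "p2 = d * p2'" "primitive q' p1' p2'"
      using divide_by_content[of q p1 p2] less(2) by (metis less_irrefl)
    have q': "0 < q'" using d(1,2) less(2) by (simp add: zero_less_mult_iff)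
    have d1: "1 \<le> real_of_int d" using d(1) by simp
    have sh: "\<bar>q' * u - p\<bar> \<le> \<bar>d * q' * u - d * p\<bar>" for u :: real and p :: int
    proof -
      have "d * q' * u - d * p = d * (q' * u - p)" by (simp add: algebra_simps)
      then have "\<bar>d * q' * u - d * p\<bar> = d * \<bar>q' * u - p\<bar>" using d(1) by (simp add: abs_mult)
      then show ?thesis using mult_right_mono[OF d1, of "\<bar>q' * u - p\<bar>"] by simp
    qed
    have "\<bar>q' * x - p1'\<bar> * \<bar>q' * y - p2'\<bar> \<le> \<bar>q * x - p1\<bar> * \<bar>q * y - p2\<bar>"
      using sh[of x p1'] sh[of y p2'] unfolding d(2-4) of_int_mult by (intro mult_mono) auto
    then have "\<not> q' < q" using IH[OF q', of p1' p2'] bad by fastforce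
    moreover have "q' \<le> q" using d(1,2) q' mult_right_mono[of 1 d q'] by simp
    ultimately have "q' = q" by simp
    then have "d = 1" using d(2) q' by simp
    then have prim: "primitive q p1 p2" using d by simp
    obtain s and i j l :: nat and L where ex: "2 ^ l \<le> real_of_int q" "real_of_int q < 2 * 2 ^ l"
      "(2::real) ^ i * 2 ^ j \<le> 8 * 2 ^ l"
      "near_point (\<theta> * sqrt (2 ^ l / Q)) (2 ^ i) (real (2 ^ j div 2)) (q, flip s (p1, p2)) (flip s (x, y))"
      "rational_line (2 ^ i) (real (2 ^ j div 2)) (q, flip s (p1, p2)) L"
      using exists_near_rational_line[OF pos(1,3) less(2) bad] by metis
    obtain r1 r2 where r: "flip s (p1, p2) = (r1, r2)" by fastforce
    obtain u v where uv: "flip s (x, y) = (u, v)" by fastforce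
    have prim': "primitive q r1 r2"
      using prim r unfolding primitive_def by (auto simp: flip_def split: if_splits) (metis add.commute add.left_commute)+
    define a b bb t g where "a = (2::real) ^ i" and "b = real (2 ^ j div 2)" and "bb = (2::real) ^ j"
      and "t = sqrt (2 ^ l / Q)" and "g = excess Q (i, j, l) powr (1 / 4)"
    note ab = a_def[symmetric] b_def[symmetric] t_def[symmetric]
    have "2 ^ l \<le> Q" using ex(1) less(3) by linarith
    then have cl: "(i, j, l) \<in> classes Q" using ex(3) by (simp add: classes_def)
    obtain n where n: "W (i, j, l) n" "snd (B n) \<le> 6 * \<theta> * \<omega> * class_scale Q (i, j, l)" using scale[OF cl] by blast
    let ?K = "candidates \<theta> Q s (i, j, l) (B n)"
    define M1 where "M1 = pick_line i j (q, r1, r2)"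
    have in1: "M1 \<in> ?K"
      unfolding candidates_def prod.case M1_def using prim' ex[unfolded r] z[of n]
      by (intro CollectI exI[of _ q] exI[of _ r1] exI[of _ r2] conjI refl exI[of _ L] bexI[of _ "(x, y)"])
    then have ne: "?K \<noteq> {}" by blast
    define M2 where "M2 = (SOME L. L \<in> ?K)"
    have in2: "M2 \<in> ?K" unfolding M2_def using in1 by (rule someI)
    have l1: "rational_line a b (q, r1, r2) M1"
      unfolding M1_def pick_line_def a_def b_def by (rule someI[of _ L]) (rule ex(5)[unfolded r])
    have n1: "near_point (\<theta> * t) a b (q, r1, r2) (u, v)" using ex(4) r uv by (simp add: ab)
    obtain q2 s1 s2 z2 where c2: "M2 = pick_line i j (q2, s1, s2)" "rational_line a b (q2, s1, s2) M2"
      "primitive q2 s1 s2" "2 ^ l \<le> real_of_int q2" "real_of_int q2 < 2 * 2 ^ l" "z2 \<in> ball_set (B n)"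
      "near_point (\<theta> * t) a b (q2, s1, s2) (flip s z2)"
      by (rule candidates_line[OF in2, folded a_def b_def t_def])
    obtain u2 v2 where uv2: "flip s z2 = (u2, v2)" by fastforce
    obtain A1 B1 C1 where M1: "M1 = (A1, B1, C1)" by (cases M1)
    obtain A2 B2 C2 where M2: "M2 = (A2, B2, C2)" by (cases M2)
    have tQ: "t\<^sup>2 * Q = 2 ^ l" and t0: "0 < t" using pos(3) by (simp_all add: t_def)
    have E1: "1 \<le> excess Q (i, j, l)" by (rule excess_ge_1[OF cl pos(3)])
    have "g ^ 4 = excess Q (i, j, l)" using E1 by (simp add: g_def powr_power)
    then have g: "1 \<le> g" "g ^ 4 * (a * bb) = 8 * Q"
      using E1 by (simp_all add: g_def ge_one_powr_ge_zero) (simp add: a_def bb_def excess_def)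
    have b2: "b \<le> bb / 2" unfolding b_def bb_def using div_le_mono by (cases j) auto
    have dd: "dist (x, y) z2 \<le> 2 * snd (B n)"
      using z[of n] c2(6) dist_triangle3[of "(x, y)" z2 "fst (B n)"] by (simp add: ball_set_def)
    have fd: "\<bar>u - u2\<bar> \<le> 2 * snd (B n)" "\<bar>v - v2\<bar> \<le> 2 * snd (B n)"
      using dist_fst_le[of "(x, y)" z2] dist_snd_le[of "(x, y)" z2] dd uv uv2
      by (cases z2; auto simp: flip_def dist_real_def split: if_splits)+
    have rho: "snd (B n) \<le> \<omega> * g * (6 * \<theta> / (a * t * Q))"
    proof -
      have "6 * \<theta> * \<omega> * class_scale Q (i, j, l) = \<omega> * (g * (6 * \<theta> / (t * Q) / a))"
        using class_scale_width[of Q "(i, j, l)" \<theta>] by (simp add: g_def t_def a_def strip_width_def mult_ac)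
      then show ?thesis using n(2) by (simp add: mult_ac)
    qed
    have good: "\<theta>\<^sup>2 / Q < \<bar>k * u - m1\<bar> * \<bar>k * v - m2\<bar>" if "0 < k" "k < t\<^sup>2 * Q" for k m1 m2 :: int
    proof -
      have "k < q" using that(2) ex(1) unfolding tQ by linarith
      then show ?thesis using IH[OF that(1), of m1 m2] IH[OF that(1), of m2 m1] uv
        by (auto simp: flip_def mult.commute split: if_splits)
    qed
    have "M1 = M2"
    proof (rule ccontr)
      assume "M1 \<noteq> M2"
      then have "(A1, B1, C1) \<noteq> (A2, B2, C2)" by (simp add: M1 M2)
      from unique_line[OF pos(1) t0 pos(3,2) g(1) _ _ _ b2 g(2) \<theta> rho fd prim' _ _ c2(3) _ _ l1[unfolded M1]
          c2(2)[unfolded M2] n1 c2(7)[unfolded uv2] good this]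
      have "(q, r1, r2) = (q2, s1, s2)" using ex(1,2) c2(4,5) by (simp add: tQ a_def b_def bb_def)
      then show False using \<open>M1 \<noteq> M2\<close> c2(1) by (simp add: M1_def)
    qed
    then have "(x, y) \<notin> hyperplane_nbhd (line_set s M1) (strip_width \<theta> Q (i, j, l))"
      using avoid[OF cl n(1) ne] by (simp add: strip_def M2_def)
    moreover have "\<bar>A1 * u + B1 * v + C1\<bar> \<le> 6 * \<theta> / (t * Q)"
      using near_point_line_bound[OF l1[unfolded M1] n1 pos(1) t0 pos(3)] ex(1) by (simp add: tQ)
    then have "(x, y) \<in> hyperplane_nbhd (line_set s (A1, B1, C1)) (6 * \<theta> / (t * Q) / a)"
      using l1 uv by (intro line_set_nbhd) (auto simp: M1 rational_line_def a_def)
    ultimately show False by (simp add: strip_width_def M1 t_def a_def)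
  qed
qed

section \<open>Alice's strategy for the set of the theorem\<close>

lemma nearest_int_dist_prod:
  assumes "\<And>(p1::int) (p2::int). c < \<bar>real q * x - p1\<bar> * \<bar>real q * y - p2\<bar>"
  shows "c < \<langle>real q * x\<rangle> * \<langle>real q * y\<rangle>"
  using assms by (simp add: nearest_int_dist_def)

lemma E_set_I:
  assumes c: "0 < c" and Q: "\<And>m. 0 < Q m" "\<And>m. 1 \<le> Q m"
    and bound: "\<And>m (q::nat). m1 \<le> m \<Longrightarrow> 1 \<le> q \<Longrightarrow> real q \<le> Q m \<Longrightarrow> c / Q m < \<langle>real q * x\<rangle> * \<langle>real q * y\<rangle>"
  shows "(x, y) \<in> E_set Q"
proof -
  define f where "f m = Q m * (MIN q\<in>{q::nat. 1 \<le> q \<and> real q \<le> Q m}. \<langle>real q * x\<rangle> * \<langle>real q * y\<rangle>)" for m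
  have "c \<le> f m" if m: "m1 \<le> m" for m
  proof -
    let ?q = "{q::nat. 1 \<le> q \<and> real q \<le> Q m}"
    have "?q \<subseteq> {..nat \<lfloor>Q m\<rfloor>}" by (auto simp: le_nat_floor)
    then have fin: "finite ?q" using finite_subset by blast
    have "1 \<in> ?q" using Q(2)[of m] by simp
    then have ne: "?q \<noteq> {}" by blast
    have "c / Q m \<le> (MIN q\<in>?q. \<langle>real q * x\<rangle> * \<langle>real q * y\<rangle>)"
      using fin ne bound[OF m] by (subst Min_ge_iff) (auto intro: less_imp_le)
    then show ?thesis using Q(1)[of m] by (simp add: f_def field_simps)
  qed
  then have "ereal c \<le> liminf (\<lambda>m. ereal (f m))"
    by (intro Liminf_bounded) (auto simp: eventually_sequentially)
  then have "0 < liminf (\<lambda>m. ereal (f m))" using c by (metis ereal_less(2) less_le_trans)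
  then show ?thesis by (simp add: E_set_def f_def)
qed

lemma E_set_beta_HAW:
  fixes Q :: "nat \<Rightarrow> real"
  assumes mono: "strict_mono Q" and pos: "\<And>m. 0 < Q m" and Q0: "1 < Q 0"
    and lim: "filterlim Q at_top sequentially"
    and \<tau>: "1 < \<tau>" "0 < c0" "\<And>m. c0 * Q m powr \<tau> \<le> Q (Suc m)"
    and \<beta>: "0 < \<beta>" "\<beta> < 1"
  shows "beta_HAW \<beta> (E_set Q)"
proof -
  obtain c \<epsilon> where c: "0 < c" and \<epsilon>: "0 < \<epsilon>"
    and game: "\<And>(F :: (real \<times> real) game_ball \<Rightarrow> (real \<times> real) game_nbhd set) S.
      \<lbrakk>\<And>B. 0 < snd B \<Longrightarrow> finite (F B);
       \<And>B M. 0 < snd B \<Longrightarrow> M \<in> F B \<Longrightarrow> affine_hyperplane (fst M) \<and> 0 < snd M;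
       \<And>B. 0 < snd B \<Longrightarrow> (\<Sum>M\<in>F B. snd M powr c) \<le> (\<epsilon> * snd B) powr c;
       \<And>B z. \<lbrakk>\<And>n. 0 < snd (B n); \<And>n. \<beta> * snd (B n) \<le> snd (B (Suc n));
               (\<lambda>n. snd (B n)) \<longlonglongrightarrow> 0; \<And>n. z \<in> ball_set (B n);
               \<And>n M. M \<in> F (B n) \<Longrightarrow> z \<notin> hyperplane_nbhd (fst M) (snd M)\<rbrakk> \<Longrightarrow> z \<in> S\<rbrakk>
      \<Longrightarrow> beta_HAW \<beta> S"
    by (rule potential_beta_HAW[OF \<beta>, where 'a = "real \<times> real"]) blast
  have c4: "0 < c / 4" using c by simp
  obtain m0 S where S: "0 < S" and Q1: "\<And>m. m0 \<le> m \<Longrightarrow> 1 \<le> Q m"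
    and finT: "\<And>R. 0 < R \<Longrightarrow> finite (active_classes Q m0 \<beta> R)"
    and sumT: "\<And>R. 0 < R \<Longrightarrow> (\<Sum>(m, \<kappa>)\<in>active_classes Q m0 \<beta> R. excess (Q m) \<kappa> powr - (c / 4)) \<le> S"
    by (rule class_sum_bound[OF lim pos mono \<tau> \<beta>(1) c4]) blast
  \<comment> \<open>The constant \<omega> makes 2 S (\<rho>/(\<omega>\<beta>))^c at most
    (\<epsilon>\<rho>)^c, where the 2 counts the values of the flag. There is no circularity in
    fixing \<theta> afterwards: a strip active at radius \<rho> has width at most
    \<rho>/(\<omega>\<beta>) times \<open>excess\<close>^(-1/4), in which \<theta> has
    cancelled.\<close>
  define \<omega> where "\<omega> = max 1 ((2 * S) powr (1 / c) / (\<epsilon> * \<beta>))"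
  have \<omega>: "1 \<le> \<omega>" "(2 * S) powr (1 / c) \<le> \<epsilon> * \<beta> * \<omega>"
    using \<epsilon> \<beta> by (auto simp: \<omega>_def max_def field_simps)
  define \<theta> where "\<theta> = 1 / (200000 * \<omega>\<^sup>2)"
  have \<theta>: "0 < \<theta>" "\<theta> * \<omega>\<^sup>2 = 1 / 200000" using \<omega>(1) by (auto simp: \<theta>_def)
  define u where "u = 6 * \<theta> * \<omega>"
  have u: "0 < u" using \<theta> \<omega> by (simp add: u_def)
  define I where "I B = {(s, m, \<kappa>). (m, \<kappa>) \<in> active_classes Q m0 \<beta> (snd B / u) \<and> candidates \<theta> (Q m) s \<kappa> B \<noteq> {}}" for B
  define F where "F B = (\<lambda>(s, m, \<kappa>). strip \<theta> (Q m) s \<kappa> B) ` I B" for B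
  have sw0: "0 < strip_width \<theta> (Q m) \<kappa>" for m \<kappa>
    using \<theta>(1) pos[of m] by (cases \<kappa>) (simp add: strip_width_def)
  have finI: "finite (I B)" if "0 < snd B" for B
  proof (rule finite_subset)
    show "I B \<subseteq> (UNIV :: bool set) \<times> active_classes Q m0 \<beta> (snd B / u)" by (auto simp: I_def)
    show "finite ((UNIV :: bool set) \<times> active_classes Q m0 \<beta> (snd B / u))" using finT[of "snd B / u"] that u by simp
  qed
  show ?thesis
  proof (rule game[of F])
    fix B :: "(real \<times> real) game_ball" assume B: "0 < snd B"
    show "finite (F B)" using finI[OF B] by (simp add: F_def)
    define R where "R = snd B / u"
    have R: "0 < R" using B u by (simp add: R_def)
    have w: "strip_width \<theta> (Q m) \<kappa> powr c \<le> (snd B / (\<omega> * \<beta>)) powr c * excess (Q m) \<kappa> powr - (c / 4)"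
      if "(m, \<kappa>) \<in> active_classes Q m0 \<beta> R" for m \<kappa>
    proof -
      have \<kappa>: "\<kappa> \<in> classes (Q m)" "\<beta> * class_scale (Q m) \<kappa> \<le> R" using that by (auto simp: active_classes_def)
      have E: "1 \<le> excess (Q m) \<kappa>" using excess_ge_1[OF \<kappa>(1) pos] .
      have "strip_width \<theta> (Q m) \<kappa> = 6 * \<theta> * class_scale (Q m) \<kappa> * excess (Q m) \<kappa> powr - (1 / 4)"
        using class_scale_width[of "Q m" \<kappa> \<theta>] E by (simp add: powr_minus field_simps)
      also have "\<dots> \<le> 6 * \<theta> * (R / \<beta>) * excess (Q m) \<kappa> powr - (1 / 4)"
        using \<kappa>(2) \<theta>(1) \<beta>(1) by (intro mult_right_mono mult_left_mono) (auto simp: field_simps)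
      also have "6 * \<theta> * (R / \<beta>) = snd B / (\<omega> * \<beta>)" using \<theta>(1) by (simp add: R_def u_def)
      finally have "strip_width \<theta> (Q m) \<kappa> powr c \<le> (snd B / (\<omega> * \<beta>) * excess (Q m) \<kappa> powr - (1 / 4)) powr c"
        using sw0[of m \<kappa>] c by (intro powr_mono2) auto
      also have "\<dots> = (snd B / (\<omega> * \<beta>)) powr c * excess (Q m) \<kappa> powr - (c / 4)"
        unfolding powr_mult by (simp add: powr_powr)
      finally show ?thesis .
    qed
    have "(\<Sum>M\<in>F B. snd M powr c) \<le> (\<Sum>(s, m, \<kappa>)\<in>I B. strip_width \<theta> (Q m) \<kappa> powr c)"
      unfolding F_def using sum_image_le[OF finI[OF B], of "\<lambda>M. snd M powr c" "\<lambda>(s, m, \<kappa>). strip \<theta> (Q m) s \<kappa> B"]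
      by (simp add: strip_def case_prod_unfold o_def)
    also have "\<dots> \<le> (\<Sum>(s, m, \<kappa>)\<in>(UNIV :: bool set) \<times> active_classes Q m0 \<beta> R. strip_width \<theta> (Q m) \<kappa> powr c)"
      using finT[OF R] by (intro sum_mono2) (auto simp: I_def R_def)
    also have "\<dots> = (\<Sum>s\<in>(UNIV :: bool set). \<Sum>(m, \<kappa>)\<in>active_classes Q m0 \<beta> R. strip_width \<theta> (Q m) \<kappa> powr c)"
      unfolding sum.cartesian_product ..
    also have "\<dots> = 2 * (\<Sum>(m, \<kappa>)\<in>active_classes Q m0 \<beta> R. strip_width \<theta> (Q m) \<kappa> powr c)" by simp
    also have "\<dots> \<le> 2 * (\<Sum>(m, \<kappa>)\<in>active_classes Q m0 \<beta> R. (snd B / (\<omega> * \<beta>)) powr c * excess (Q m) \<kappa> powr - (c / 4))"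
      using w by (intro mult_left_mono sum_mono) auto
    also have "\<dots> = 2 * (snd B / (\<omega> * \<beta>)) powr c * (\<Sum>(m, \<kappa>)\<in>active_classes Q m0 \<beta> R. excess (Q m) \<kappa> powr - (c / 4))"
      by (simp add: sum_distrib_left case_prod_unfold mult.assoc)
    also have "\<dots> \<le> 2 * (snd B / (\<omega> * \<beta>)) powr c * S" using sumT[OF R] by (intro mult_left_mono) auto
    also have "\<dots> = (snd B / (\<omega> * \<beta>)) powr c * ((2 * S) powr (1 / c)) powr c"
      using S c by (simp add: powr_powr)
    also have "\<dots> \<le> (snd B / (\<omega> * \<beta>)) powr c * (\<epsilon> * \<beta> * \<omega>) powr c"
      using \<omega>(2) c by (intro mult_left_mono powr_mono2) auto
    also have "\<dots> = (snd B / (\<omega> * \<beta>) * (\<epsilon> * \<beta> * \<omega>)) powr c"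
      by (rule powr_mult[symmetric])
    also have "snd B / (\<omega> * \<beta>) * (\<epsilon> * \<beta> * \<omega>) = \<epsilon> * snd B" using \<omega>(1) \<beta>(1) by simp
    finally show "(\<Sum>M\<in>F B. snd M powr c) \<le> (\<epsilon> * snd B) powr c" .
    fix M assume "M \<in> F B"
    then obtain p where p: "p \<in> I B" "M = (case p of (s, m, \<kappa>) \<Rightarrow> strip \<theta> (Q m) s \<kappa> B)"
      unfolding F_def by blast
    obtain s m \<kappa> where "p = (s, m, \<kappa>)" by (cases p)
    then have M: "M = strip \<theta> (Q m) s \<kappa> B" "candidates \<theta> (Q m) s \<kappa> B \<noteq> {}"
      using p by (simp_all add: I_def)
    obtain i j l where \<kappa>: "\<kappa> = (i, j, l)" by (cases \<kappa>)
    define L where "L = (SOME L. L \<in> candidates \<theta> (Q m) s \<kappa> B)"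
    have "L \<in> candidates \<theta> (Q m) s (i, j, l) B" unfolding L_def \<kappa>[symmetric] using M(2) by (simp add: some_in_eq)
    then obtain q p1 p2 where "rational_line (2 ^ i) (real (2 ^ j div 2)) (q, p1, p2) L" by (rule candidates_line)
    moreover obtain A B' C where L: "L = (A, B', C)" by (cases L)
    ultimately have "(2::real) ^ i \<le> A" by (simp add: rational_line_def)
    then have "A \<noteq> 0" using zero_less_power[of "2::real" i] by auto
    then show "affine_hyperplane (fst M) \<and> 0 < snd M"
      using sw0 affine_hyperplane_line_set L by (simp add: M(1) strip_def L_def[symmetric])
  next
    fix B :: "nat \<Rightarrow> (real \<times> real) game_ball" and z
    assume Bpos: "\<And>n. 0 < snd (B n)" and step: "\<And>n. \<beta> * snd (B n) \<le> snd (B (Suc n))"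
      and to0: "(\<lambda>n. snd (B n)) \<longlonglongrightarrow> 0" and zB: "\<And>n. z \<in> ball_set (B n)"
      and avoid: "\<And>n M. M \<in> F (B n) \<Longrightarrow> z \<notin> hyperplane_nbhd (fst M) (snd M)"
    obtain x y where z: "z = (x, y)" by fastforce
    \<comment> \<open>For large m all scales are below the one of Bob's first ball, so no class is
      missed before the game begins. The finitely many other m do not affect the liminf.\<close>
    have "((\<lambda>m. 2 * Q m powr - (1 / 4)) \<longlongrightarrow> 2 * 0) sequentially"
      using lim by (intro tendsto_intros tendsto_neg_powr) auto
    then have "\<forall>\<^sub>F m in sequentially. 2 * Q m powr - (1 / 4) < snd (B 0) / u"
      using Bpos[of 0] u by (intro order_tendstoD(2)[where y = "2 * 0"]) auto
    then obtain m2 where m2: "\<And>m. m2 \<le> m \<Longrightarrow> 2 * Q m powr - (1 / 4) < snd (B 0) / u"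
      by (auto simp: eventually_sequentially)
    have bound: "\<theta>\<^sup>2 / Q m < \<bar>q * x - p1\<bar> * \<bar>q * y - p2\<bar>"
      if m: "max m0 m2 \<le> m" and q: "0 < q" "real_of_int q \<le> Q m" for m and q p1 p2 :: int
    proof (rule no_bad_denominator[OF \<theta>(1) \<omega>(1) pos \<theta>(2) zB[unfolded z] _ _ q])
      fix \<kappa> assume \<kappa>: "\<kappa> \<in> classes (Q m)"
      let ?v = "class_scale (Q m) \<kappa>"
      have v: "0 < ?v" "?v < snd (B 0) / u"
      proof -
        have "0 < 1 / (8 * (Q m)\<^sup>2)" using pos[of m] by simp
        also have "\<dots> \<le> ?v" using class_scale_bounds(1)[OF \<kappa>] Q1 m by simp
        finally show "0 < ?v" .
        have "?v \<le> 2 * Q m powr - (1 / 4)" using class_scale_bounds(2)[OF \<kappa>] Q1 m by simp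
        also have "\<dots> < snd (B 0) / u" using m2 m by simp
        finally show "?v < snd (B 0) / u" .
      qed
      have "(\<lambda>n. snd (B n) / u) \<longlonglongrightarrow> 0 / u" using u by (intro tendsto_intros to0) auto
      then have "\<forall>\<^sub>F n in sequentially. snd (B n) / u < ?v" using v(1) by (intro order_tendstoD(2)) auto
      then have ex: "\<exists>n. snd (B n) / u \<le> ?v" by (auto simp: eventually_sequentially intro: less_imp_le)
      \<comment> \<open>The first ball small enough for the class. Its predecessor was too large and
        one move shrinks the radius at most by \<beta>, so the class is active exactly at this ball
        and Alice has named its strip.\<close>
      define n where "n = (LEAST n. snd (B n) / u \<le> ?v)"
      have n: "snd (B n) / u \<le> ?v" unfolding n_def using ex by (rule LeastI_ex)
      then have "n \<noteq> 0" using v(2) by (metis not_le)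
      then obtain k where k: "n = Suc k" by (cases n) auto
      have "\<not> snd (B k) / u \<le> ?v" using not_less_Least[of k "\<lambda>n. snd (B n) / u \<le> ?v"] k by (simp add: n_def)
      then have "\<beta> * ?v \<le> \<beta> * (snd (B k) / u)" using \<beta>(1) by (intro mult_left_mono) auto
      also have "\<dots> \<le> snd (B n) / u" using step[of k] u k by (simp add: divide_right_mono)
      finally have "\<beta> * ?v \<le> snd (B n) / u" .
      moreover have "snd (B n) \<le> ?v * u" using n u by (simp add: pos_divide_le_eq)
      ultimately show "\<exists>n. (m, \<kappa>) \<in> active_classes Q m0 \<beta> (snd (B n) / u) \<and> snd (B n) \<le> 6 * \<theta> * \<omega> * ?v"
        using n \<kappa> m by (intro exI[of _ n]) (simp add: active_classes_def u_def mult_ac)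
    next
      fix s \<kappa> n
      assume "(m, \<kappa>) \<in> active_classes Q m0 \<beta> (snd (B n) / u)" "candidates \<theta> (Q m) s \<kappa> (B n) \<noteq> {}"
      then have "strip \<theta> (Q m) s \<kappa> (B n) \<in> F (B n)" by (force simp: F_def I_def)
      then show "(x, y) \<notin> hyperplane_nbhd (fst (strip \<theta> (Q m) s \<kappa> (B n))) (snd (strip \<theta> (Q m) s \<kappa> (B n)))"
        using avoid z by blast
    qed
    have Q1': "1 \<le> Q m" for m using strict_mono_less_eq[OF mono, of 0 m] Q0 by simp
    show "z \<in> E_set Q" unfolding z
    proof (rule E_set_I[OF _ pos Q1'])
      show "0 < \<theta>\<^sup>2" using \<theta>(1) by simp
      fix m q assume "max m0 m2 \<le> m" "1 \<le> q" "real q \<le> Q m"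
      then show "\<theta>\<^sup>2 / Q m < \<langle>real q * x\<rangle> * \<langle>real q * y\<rangle>"
        using bound[of m "int q"] by (intro nearest_int_dist_prod) auto
    qed
  qed
qed

theorem theorem1p6:
  fixes Q :: "nat \<Rightarrow> real"
  assumes "strict_mono Q"
    and "\<And>m. Q m > 0"
    and "Q 0 > 1"
    and "filterlim Q at_top sequentially"
    and "\<exists>\<tau>>1. (INF m. Q (Suc m) / Q m powr \<tau>) > 0"
  shows "HAW (E_set Q) \<and> hausdorff_dim (E_set Q) = 2"
proof -
  obtain \<tau> where \<tau>: "1 < \<tau>" "0 < (INF m. Q (Suc m) / Q m powr \<tau>)" using assms(5) by blast
  define c where "c = (INF m. Q (Suc m) / Q m powr \<tau>)"
  \<comment> \<open>A real infimum is a lower bound only for sets bounded below; positivity of Q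
    provides this.\<close>
  have "bdd_below (range (\<lambda>m. Q (Suc m) / Q m powr \<tau>))"
    by (rule bdd_belowI[of _ 0]) (auto simp: assms(2) less_imp_le)
  then have "c \<le> Q (Suc m) / Q m powr \<tau>" for m unfolding c_def by (intro cINF_lower) auto
  then have c: "c * Q m powr \<tau> \<le> Q (Suc m)" for m
    using assms(2)[of m] by (subst pos_le_divide_eq[symmetric]) (simp_all add: less_imp_neq[symmetric])
  have "HAW (E_set Q)"
    unfolding HAW_def using E_set_beta_HAW[OF assms(1-4) \<tau>(1) \<tau>(2)[folded c_def] c] by simp
  then show ?thesis using hausdorff_dim_plane_le HAW_hausdorff_dim_ge by (metis antisym)
qed

end
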